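(* Let $m,n\ge 1$ be integers, let $\mathbb{A}=(A_1,\dots,A_n),\ \mathbb{B}=(B_1,\dots,B_n)\in\mathbb{P}_m^n$, let $\omega=(w_1,\dots,w_n),\ \mu=(\mu_1,\dots,\mu_n)\in\Delta_n$, and let $0<\alpha\le z<1$. If $\mathcal{R}_{\alpha,z}(\omega;\mathbb{A})\ge I$ and $\mathcal{R}_{\alpha,z}(\mu;\mathbb{B})\ge I$, then $$\mathcal{R}_{\alpha,z}(\omega;\mathbb{A})^{1-\frac{\alpha}{z}}\circ\mathcal{R}_{\alpha,z}(\mu;\mathbb{B})^{1-\frac{\alpha}{z}}\le P_z\left(\omega\otimes\mu;\ \mathbb{A}^{\frac{1-\alpha}{z}}\circ\mathbb{B}^{\frac{1-\alpha}{z}}\right).$$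
   Context: $\mathbb{P}_m$ is the set of $m\times m$ complex positive definite Hermitian matrices and $I$ is the identity matrix. $\Delta_n$ is the set of positive probability vectors $\omega=(w_1,\dots,w_n)$, i.e. $w_j>0$ for all $j$ and $\sum_j w_j=1$. $A\le B$ means $B-A$ is positive semidefinite. For $0<\alpha\le z<1$ and $A,B\in\mathbb{P}_m$, the $\alpha$-$z$ Bures-Wasserstein quantum divergence is $$\Phi_{\alpha,z}(A,B)=\operatorname{tr}((1-\alpha)A+\alpha B)-\operatorname{tr}\left(A^{\frac{1-\alpha}{2z}}B^{\frac{\alpha}{z}}A^{\frac{1-\alpha}{2z}}\right)^z.$$ The $\alpha$-$z$ weighted right mean $\mathcal{R}_{\alpha,z}(\omega;\mathbb{A})$ is the unique minimizer (which exists) over $X\in\mathbb{P}_m$ of $X\mapsto\sum_{j=1}^n w_j\Phi_{\alpha,z}(A_j,X)$. For $A,B\in\mathbb{P}_m$ and $t\in[0,1]$, $A\#_tB=A^{1/2}(A^{-1/2}BA^{-1/2})^tA^{1/2}$. For $t\in(0,1]$, an integer $N\ge1$, $\nu=(\nu_1,\dots,\nu_N)\in\Delta_N$ and $C_1,\dots,C_N\in\mathbb{P}_m$, the matrix power mean $P_t(\nu;C_1,\dots,C_N)$ is the unique solution (which exists) $X\in\mathbb{P}_m$ of $X=\sum_{k=1}^N \nu_k\,X\#_tC_k$. For matrices, $A\circ B=[a_{ij}b_{ij}]$ is the Hadamard (entrywise) product (the Hadamard product of positive definite matrices is positive definite). For tuples, $\mathbb{A}^p=(A_1^p,\dots,A_n^p)$;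 $\mathbb{A}\circ\mathbb{B}=(A_1\circ B_1,\dots,A_1\circ B_n,\dots,A_n\circ B_1,\dots,A_n\circ B_n)\in\mathbb{P}_m^{n^2}$; and $\omega\otimes\mu=(w_1\mu_1,\dots,w_1\mu_n,\dots,w_n\mu_1,\dots,w_n\mu_n)\in\Delta_{n^2}$. *)

theory Defs
  imports "HOL-Analysis.Analysis"
begin

text \<open>
  An \<open>m \<times> m\<close> complex matrix is an element of \<open>complex ^ 'm ^ 'm\<close> with \<open>m = CARD('m)\<close>, and a tuple
  of length \<open>n\<close> is a function on a finite index type \<open>'n\<close> with \<open>n = CARD('n)\<close>.
\<close>

type_synonym 'm cmat = "complex ^ 'm ^ 'm"

definition conj_transpose :: "'m::finite cmat \<Rightarrow> 'm cmat"
  where "conj_transpose A = (\<chi> i j. cnj (A $ j $ i))"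

definition hermitian :: "'m::finite cmat \<Rightarrow> bool"
  where "hermitian A \<longleftrightarrow> conj_transpose A = A"

definition unitary :: "'m::finite cmat \<Rightarrow> bool"
  where "unitary U \<longleftrightarrow> conj_transpose U ** U = mat 1 \<and> U ** conj_transpose U = mat 1"

definition quad_form :: "'m::finite cmat \<Rightarrow> complex ^ 'm \<Rightarrow> complex"
  where "quad_form A v = (\<Sum>i\<in>UNIV. cnj (v $ i) * (A *v v) $ i)"

text \<open>For Hermitian \<open>A\<close> the form \<open>v\<^sup>* A v\<close> is real, so taking the real part loses nothing.\<close>

definition pos_semidef :: "'m::finite cmat \<Rightarrow> bool"
  where "pos_semidef A \<longleftrightarrow> hermitian A \<and> (\<forall>v. 0 \<le> Re (quad_form A v))"

definition pos_def :: "'m::finite cmat \<Rightarrow> bool"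
  where "pos_def A \<longleftrightarrow> hermitian A \<and> (\<forall>v. v \<noteq> 0 \<longrightarrow> 0 < Re (quad_form A v))"

definition loewner_le :: "'m::finite cmat \<Rightarrow> 'm cmat \<Rightarrow> bool"  (infix \<open>\<le>\<^sub>L\<close> 50)
  where "A \<le>\<^sub>L B \<longleftrightarrow> pos_semidef (B - A)"

definition diag_real :: "('m::finite \<Rightarrow> real) \<Rightarrow> 'm cmat"
  where "diag_real d = (\<chi> i j. if i = j then complex_of_real (d i) else 0)"

text \<open>
  The real power \<open>A\<^sup>p = U diag(d\<^sub>i\<^sup>p) U\<^sup>*\<close> of a positive definite matrix \<open>A = U diag(d\<^sub>i) U\<^sup>*\<close>;
  the result does not depend on the chosen diagonalisation. It is used for positive definite
  \<open>A\<close> only.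
\<close>

definition mpow :: "'m::finite cmat \<Rightarrow> real \<Rightarrow> 'm cmat"  (infixr \<open>\<up>\<close> 80)
  where "A \<up> p = (THE B. \<exists>U d. unitary U \<and> (\<forall>i. 0 < d i) \<and>
           A = U ** diag_real d ** conj_transpose U \<and>
           B = U ** diag_real (\<lambda>i. d i powr p) ** conj_transpose U)"

definition hadamard :: "'m::finite cmat \<Rightarrow> 'm cmat \<Rightarrow> 'm cmat"  (infixl \<open>\<odot>\<close> 70)
  where "A \<odot> B = (\<chi> i j. A $ i $ j * B $ i $ j)"

definition prob_vectors :: "('n::finite \<Rightarrow> real) set"
  where "prob_vectors = {w. (\<forall>j. 0 < w j) \<and> (\<Sum>j\<in>UNIV. w j) = 1}"

text \<open>
  In the second term \<open>tr (\<dots>)\<^sup>z\<close> is the trace of the \<open>z\<close>-th power. All traces involved are real.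
\<close>

definition az_divergence :: "real \<Rightarrow> real \<Rightarrow> 'm::finite cmat \<Rightarrow> 'm cmat \<Rightarrow> real"
  where "az_divergence \<alpha> z A B =
           Re (trace ((1 - \<alpha>) *\<^sub>R A + \<alpha> *\<^sub>R B)) -
           Re (trace ((A \<up> ((1 - \<alpha>) / (2 * z)) ** B \<up> (\<alpha> / z) ** A \<up> ((1 - \<alpha>) / (2 * z))) \<up> z))"

definition right_mean ::
    "real \<Rightarrow> real \<Rightarrow> ('n::finite \<Rightarrow> real) \<Rightarrow> ('n \<Rightarrow> 'm::finite cmat) \<Rightarrow> 'm cmat"
  where "right_mean \<alpha> z w A =
           (THE X. is_arg_min (\<lambda>Y. \<Sum>j\<in>UNIV. w j * az_divergence \<alpha> z (A j) Y) pos_def X)"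

definition geom_mean :: "real \<Rightarrow> 'm::finite cmat \<Rightarrow> 'm cmat \<Rightarrow> 'm cmat"
  where "geom_mean t A B =
           A \<up> (1 / 2) ** (A \<up> (- 1 / 2) ** B ** A \<up> (- 1 / 2)) \<up> t ** A \<up> (1 / 2)"

definition power_mean ::
    "real \<Rightarrow> ('k::finite \<Rightarrow> real) \<Rightarrow> ('k \<Rightarrow> 'm::finite cmat) \<Rightarrow> 'm cmat"
  where "power_mean t \<nu> C =
           (THE X. pos_def X \<and> X = (\<Sum>k\<in>UNIV. \<nu> k *\<^sub>R geom_mean t X (C k)))"

text \<open>
  The tuples of length \<open>n\<^sup>2\<close> are indexed by \<open>'n \<times> 'n\<close>, the pair \<open>(i, j)\<close> standing for the
  lexicographic position \<open>(i - 1) n + j\<close>. Both tuples use the same indexing, and the power mean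
  is invariant under simultaneous reindexing of its arguments.
\<close>

definition tuple_mpow :: "('n \<Rightarrow> 'm::finite cmat) \<Rightarrow> real \<Rightarrow> 'n \<Rightarrow> 'm cmat"
  where "tuple_mpow A p = (\<lambda>j. A j \<up> p)"

definition tuple_hadamard ::
    "('n \<Rightarrow> 'm::finite cmat) \<Rightarrow> ('n \<Rightarrow> 'm cmat) \<Rightarrow> 'n \<times> 'n \<Rightarrow> 'm cmat"
  where "tuple_hadamard A B = (\<lambda>(i, j). A i \<odot> B j)"

definition weight_tensor :: "('n \<Rightarrow> real) \<Rightarrow> ('n \<Rightarrow> real) \<Rightarrow> 'n \<times> 'n \<Rightarrow> real"
  where "weight_tensor w u = (\<lambda>(i, j). w i * u j)"

end

theory Submission
  imports Defs
begin

text \<open>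
  Write \<open>C\<^sub>j = A\<^sub>j\<^bsup>(1-\<alpha>)/z\<^esup>\<close> and \<open>Y = X\<^bsup>\<alpha>/z\<^esup>\<close>. Klein's inequality shows that \<open>X\<close> is the right mean as soon as
  \<open>X\<^bsup>1-\<alpha>/z\<^esup> = \<Sum>\<^sub>j w\<^sub>j (X\<^bsup>-\<alpha>/z\<^esup> #\<^sub>z C\<^sub>j)\<close>, equivalently
  \<open>Y\<^bsup>z/\<alpha>\<^esup> = \<Sum>\<^sub>j w\<^sub>j (Y\<^bsup>1/2\<^esup> C\<^sub>j Y\<^bsup>1/2\<^esup>)\<^sup>z\<close>, and the latter equation has a solution by Brouwer's theorem.
  If \<open>X \<ge> I\<close>, then \<open>X\<^bsup>-\<alpha>/z\<^esup> \<le> S := X\<^bsup>1-\<alpha>/z\<^esup>\<close>, so \<open>S \<le> \<Sum>\<^sub>j w\<^sub>j (S #\<^sub>z C\<^sub>j)\<close> because the geometric mean is monotone.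
  Its supermultiplicativity under Hadamard products turns two such inequalities, for \<open>S\<close> and \<open>T\<close>, into
  \<open>S \<circ> T \<le> F (S \<circ> T)\<close>, where \<open>F\<close> is the map whose fixed point is the power mean; since
  \<open>F (r P) = r\<^bsup>1-z\<^esup> F P\<close>, such a subsolution lies below the fixed point. Both properties of \<open>#\<^sub>t\<close> are
  proved for \<open>t = 1/2\<close> by the extremal characterisation through positive block matrices and extend
  to \<open>[0,1]\<close> because they survive midpoints and limits of exponents.
\<close>

section \<open>Adjoints, inner products and the spectral theorem\<close>

notation conj_transpose (\<open>_\<^sup>\<dagger>\<close> [1000] 1000)

lemma conj_transpose_nth [simp]: "(A::'m::finite cmat)\<^sup>\<dagger> $ i $ j = cnj (A $ j $ i)"
  by (simp add: conj_transpose_def)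

lemma conj_transpose_conj_transpose [simp]: "(A::'m::finite cmat)\<^sup>\<dagger>\<^sup>\<dagger> = A"
  by (simp add: vec_eq_iff)

lemma conj_transpose_mult: "((A::'m::finite cmat) ** B)\<^sup>\<dagger> = B\<^sup>\<dagger> ** A\<^sup>\<dagger>"
  by (simp add: vec_eq_iff matrix_matrix_mult_def mult.commute)

lemma conj_transpose_mat_1 [simp]: "(mat 1 :: 'm::finite cmat)\<^sup>\<dagger> = mat 1"
  by (auto simp: vec_eq_iff mat_def)

lemma bounded_linear_conj_transpose: "bounded_linear (conj_transpose :: 'm::finite cmat \<Rightarrow> 'm cmat)"
  by (intro linear_conv_bounded_linear[THEN iffD1] linearI) (simp_all add: vec_eq_iff)

lemmas conj_transpose_add = linear_add[OF bounded_linear.linear[OF bounded_linear_conj_transpose]]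
lemmas conj_transpose_diff = linear_diff[OF bounded_linear.linear[OF bounded_linear_conj_transpose]]
lemmas conj_transpose_scaleR = linear_cmul[OF bounded_linear.linear[OF bounded_linear_conj_transpose]]

text \<open>Boundedness is automatic in finite dimension; interpreting the locale supplies the rules
  for sums, scalars and continuity that the later computations use.\<close>

lemma bounded_bilinear_matrix_mult:
  "bounded_bilinear ((**) :: 'm::finite cmat \<Rightarrow> 'm cmat \<Rightarrow> 'm cmat)"
  by (auto simp: bilinear_conv_bounded_bilinear[symmetric] bilinear_def vec_eq_iff
      matrix_matrix_mult_def algebra_simps sum.distrib scaleR_sum_right intro!: linearI)

interpretation matrix_mult: bounded_bilinear "(**) :: 'm::finite cmat \<Rightarrow> 'm cmat \<Rightarrow> 'm cmat"
  by (rule bounded_bilinear_matrix_mult)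

lemma bounded_bilinear_matrix_vector_mult:
  "bounded_bilinear ((*v) :: 'm::finite cmat \<Rightarrow> complex ^ 'm \<Rightarrow> complex ^ 'm)"
  by (auto simp: bilinear_conv_bounded_bilinear[symmetric] bilinear_def vec_eq_iff
      matrix_vector_mult_def algebra_simps sum.distrib scaleR_sum_right intro!: linearI)

interpretation matrix_vector_mult:
  bounded_bilinear "(*v) :: 'm::finite cmat \<Rightarrow> complex ^ 'm \<Rightarrow> complex ^ 'm"
  by (rule bounded_bilinear_matrix_vector_mult)

lemma bounded_bilinear_hadamard:
  "bounded_bilinear (hadamard :: 'm::finite cmat \<Rightarrow> 'm cmat \<Rightarrow> 'm cmat)"
  by (auto simp: bilinear_conv_bounded_bilinear[symmetric] bilinear_def vec_eq_iff
      hadamard_def algebra_simps intro!: linearI)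

interpretation hadamard: bounded_bilinear "hadamard :: 'm::finite cmat \<Rightarrow> 'm cmat \<Rightarrow> 'm cmat"
  by (rule bounded_bilinear_hadamard)

lemma bounded_linear_trace: "bounded_linear (trace :: 'm::finite cmat \<Rightarrow> complex)"
  by (intro linear_conv_bounded_linear[THEN iffD1] linearI)
    (simp_all add: trace_def sum.distrib scaleR_sum_right)

lemmas trace_add = linear_add[OF bounded_linear.linear[OF bounded_linear_trace]]
lemmas trace_diff = linear_diff[OF bounded_linear.linear[OF bounded_linear_trace]]
lemmas trace_scaleR = linear_cmul[OF bounded_linear.linear[OF bounded_linear_trace]]
lemmas trace_sum = linear_sum[OF bounded_linear.linear[OF bounded_linear_trace]]

lemmas matrix_mult_continuous_on [continuous_intros] = matrix_mult.continuous_on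
lemmas matrix_vector_mult_continuous_on [continuous_intros] = matrix_vector_mult.continuous_on
lemmas conj_transpose_continuous_on [continuous_intros] =
  bounded_linear.continuous_on[OF bounded_linear_conj_transpose]

text \<open>The complex form is kept beside its real part \<open>\<bullet>\<close> because
  eigenvectors must be orthonormal over the complex numbers for the matrix of eigenvectors to be
  unitary.\<close>

definition cinner :: "complex ^ 'm::finite \<Rightarrow> complex ^ 'm \<Rightarrow> complex"
  where "cinner v w = (\<Sum>i\<in>UNIV. cnj (v $ i) * w $ i)"

lemma Re_cinner: "Re (cinner v w) = v \<bullet> w"
  by (simp add: cinner_def inner_vec_def inner_complex_def)

lemma cinner_commute: "cinner v w = cnj (cinner w v)"
  by (simp add: cinner_def mult.commute)

lemma cinner_self: "cinner v v = complex_of_real (v \<bullet> v)"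
  by (simp add: cinner_def inner_vec_def inner_complex_def complex_eq_iff mult.commute)

lemma cinner_matrix_vector_mult: "cinner v (A *v w) = cinner (A\<^sup>\<dagger> *v v) w"
proof -
  have "cinner v (A *v w) = (\<Sum>i\<in>UNIV. \<Sum>j\<in>UNIV. cnj (v $ i) * (A $ i $ j * w $ j))"
    by (simp add: cinner_def matrix_vector_mult_def sum_distrib_left)
  also have "\<dots> = (\<Sum>j\<in>UNIV. \<Sum>i\<in>UNIV. cnj (v $ i) * (A $ i $ j * w $ j))"
    by (rule sum.swap)
  also have "\<dots> = cinner (A\<^sup>\<dagger> *v v) w"
    by (simp add: cinner_def matrix_vector_mult_def sum_distrib_left sum_distrib_right mult_ac)
  finally show ?thesis .
qed

lemma inner_matrix_vector_mult: "v \<bullet> (A *v w) = (A\<^sup>\<dagger> *v v) \<bullet> w"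
  using cinner_matrix_vector_mult[of v A w] by (metis Re_cinner)

lemma Re_quad_form: "Re (quad_form A v) = v \<bullet> (A *v v)"
  by (simp add: quad_form_def flip: Re_cinner cinner_def)

lemma cinner_add_right: "cinner v (w + x) = cinner v w + cinner v x"
  by (simp add: cinner_def sum.distrib algebra_simps)

lemma cinner_scaleR_right: "cinner v (r *\<^sub>R w) = r *\<^sub>R cinner v w"
  by (simp add: cinner_def scaleR_sum_right)

lemma cinner_scaleR_left: "cinner (r *\<^sub>R v) w = r *\<^sub>R cinner v w"
  by (simp add: cinner_def scaleR_sum_right)

lemma cinner_diff_right: "cinner v (w - x) = cinner v w - cinner v x"
  by (simp add: cinner_def sum_subtractf algebra_simps)

lemma continuous_on_cinner_right: "continuous_on S (cinner v)"
  unfolding cinner_def by (intro continuous_intros)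

text \<open>Fewer than \<open>m\<close> vectors have a common nonzero orthogonal vector: pad their conjugates with
  a zero row to a singular matrix.\<close>

lemma exists_orthogonal_vector:
  fixes u :: "'m::finite \<Rightarrow> complex ^ 'm"
  assumes "k \<notin> I"
  obtains x where "x \<noteq> 0" "\<And>i. i \<in> I \<Longrightarrow> cinner (u i) x = 0"
proof -
  define R :: "'m cmat" where "R = (\<chi> i j. if i \<in> I then cnj (u i $ j) else 0)"
  have "row k R = 0"
    using assms by (simp add: row_def R_def vec_eq_iff)
  then have "\<not> invertible R"
    using det_zero_row(2) invertible_det_nz by blast
  then obtain x where x: "x \<noteq> 0" "R *v x = 0"
    using matrix_left_invertible_ker invertible_left_inverse by metis
  have "cinner (u i) x = 0" if "i \<in> I" for i
  proof -
    have "(R *v x) $ i = 0" using x by simp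
    with that show ?thesis by (simp add: R_def matrix_vector_mult_def cinner_def)
  qed
  with x that show thesis by blast
qed

text \<open>The orthogonal complement \<open>W\<close> of the given eigenvectors is invariant under
  the Hermitian \<open>A\<close>. A maximiser \<open>x\<close> of the quadratic form on the unit
  sphere of \<open>W\<close> is an eigenvector, since otherwise the residual
  \<open>A *v x - l *\<^sub>R x\<close> would be a direction of increase.\<close>

lemma exists_eigenvector_orthogonal:
  fixes A :: "'m::finite cmat" and u :: "'m \<Rightarrow> complex ^ 'm"
  assumes herm: "hermitian A" and eig: "\<And>i. i \<in> I \<Longrightarrow> A *v u i = d i *\<^sub>R u i" and k: "k \<notin> I"
  obtains x l where "norm x = 1" "A *v x = l *\<^sub>R x" "\<And>i. i \<in> I \<Longrightarrow> cinner (u i) x = 0"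
proof -
  define W where "W = {x. \<forall>i\<in>I. cinner (u i) x = 0}"
  have W_add: "x + y \<in> W" if "x \<in> W" "y \<in> W" for x y
    using that by (simp add: W_def cinner_add_right)
  have W_diff: "x - y \<in> W" if "x \<in> W" "y \<in> W" for x y
    using that by (simp add: W_def cinner_diff_right)
  have W_scaleR: "r *\<^sub>R x \<in> W" if "x \<in> W" for r x
    using that by (simp add: W_def cinner_scaleR_right)
  have W_A: "A *v x \<in> W" if "x \<in> W" for x
    using that eig herm by (auto simp: W_def cinner_matrix_vector_mult hermitian_def cinner_scaleR_left)
  have "closed W"
    unfolding W_def Collect_ball_eq
    using closed_Collect_eq[OF continuous_on_cinner_right continuous_on_const] by blast
  then have comp: "compact (W \<inter> sphere 0 1)"
    by (intro closed_Int_compact) auto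
  obtain x0 where x0: "x0 \<noteq> 0" "x0 \<in> W"
    by (rule exists_orthogonal_vector[OF k, of u]) (simp add: W_def)
  then have "(1 / norm x0) *\<^sub>R x0 \<in> W \<inter> sphere 0 1"
    using W_scaleR by simp
  then have ne: "W \<inter> sphere 0 1 \<noteq> {}" by blast
  have "continuous_on (W \<inter> sphere 0 1) (\<lambda>y. y \<bullet> (A *v y))"
    by (intro continuous_intros)
  from continuous_attains_sup[OF comp ne this]
  obtain x where x: "x \<in> W" "norm x = 1"
    and max: "\<And>y. y \<in> W \<Longrightarrow> norm y = 1 \<Longrightarrow> y \<bullet> (A *v y) \<le> x \<bullet> (A *v x)"
    by auto
  define l where "l = x \<bullet> (A *v x)"
  \<comment> \<open>Homogenising removes the sphere constraint: \<open>Q\<close> is nonpositive on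
    all of \<open>W\<close> and vanishes at \<open>x\<close>.\<close>
  define Q where "Q y = y \<bullet> (A *v y) - l * (y \<bullet> y)" for y
  have Q_le: "Q y \<le> 0" if "y \<in> W" for y
  proof (cases "y = 0")
    case False
    define e where "e = (1 / norm y) *\<^sub>R y"
    have y: "y = norm y *\<^sub>R e" and e: "e \<in> W" "norm e = 1"
      using False that W_scaleR by (auto simp: e_def)
    have "Q (c *\<^sub>R e) = c\<^sup>2 * Q e" for c
      by (simp add: Q_def matrix_vector_mult.scaleR_right power2_eq_square algebra_simps)
    from this[of "norm y"] have "Q y = (norm y)\<^sup>2 * Q e"
      by (simp add: y[symmetric])
    moreover have "Q e \<le> 0"
      using max[OF e] e by (simp add: Q_def l_def norm_eq_1)
    ultimately show ?thesis
      by (simp add: mult_nonneg_nonpos)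
  qed (simp add: Q_def)
  define r where "r = A *v x - l *\<^sub>R x"
  have r: "r \<in> W"
    unfolding r_def using x W_A W_diff W_scaleR by blast
  have sym: "x \<bullet> (A *v r) = r \<bullet> (A *v x)"
    using herm by (simp only: inner_matrix_vector_mult[of x] hermitian_def inner_commute[of r])
  have xx: "x \<bullet> x = 1"
    using x by (simp add: norm_eq_1)
  have rr: "r \<bullet> r = r \<bullet> (A *v x) - l * (x \<bullet> r)"
    by (subst (2) r_def) (simp add: inner_diff_right inner_commute)
  have "Q x = 0"
    using xx by (simp add: Q_def l_def)
  moreover have "Q (x + t *\<^sub>R r) = Q x + 2 * t * (r \<bullet> (A *v x) - l * (x \<bullet> r)) + t\<^sup>2 * Q r" for t
    unfolding Q_def matrix_vector_mult.add_right matrix_vector_mult.scaleR_right inner_add_left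
      inner_add_right inner_scaleR_left inner_scaleR_right sym inner_commute[of r x] power2_eq_square
    by algebra
  ultimately have expand: "Q (x + t *\<^sub>R r) = 2 * t * (r \<bullet> r) + t\<^sup>2 * Q r" for t
    using rr by simp
  have "r \<bullet> r \<le> 0"
  proof (rule ccontr)
    assume pos: "\<not> r \<bullet> r \<le> 0"
    \<comment> \<open>With this step size \<open>t * Q r = t - r \<bullet> r\<close>, so the bracket
      \<open>2 * (r \<bullet> r) + t * Q r\<close> equals \<open>r \<bullet> r + t\<close>, which is
      positive.\<close>
    define t where "t = (r \<bullet> r) / (1 - Q r)"
    have D: "1 - Q r > 0" using Q_le[OF r] by linarith
    have t: "t > 0" unfolding t_def using pos D by (intro divide_pos_pos) linarith+
    have "2 * t * (r \<bullet> r) + t\<^sup>2 * Q r \<le> 0"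
      using Q_le[OF W_add[OF x(1) W_scaleR[OF r]]] expand by simp
    then have "t * (2 * (r \<bullet> r) + t * Q r) \<le> 0"
      by (simp add: algebra_simps power2_eq_square)
    then have "2 * (r \<bullet> r) + t * Q r \<le> 0"
      using t by (simp add: mult_le_0_iff)
    moreover have "t * (1 - Q r) = r \<bullet> r"
      using D by (simp add: t_def)
    ultimately show False
      using t pos by (simp add: algebra_simps)
  qed
  then have "r = 0" by (meson inner_gt_zero_iff not_less)
  then have "A *v x = l *\<^sub>R x" by (simp add: r_def)
  with x show thesis by (intro that[of x l]) (auto simp: W_def)
qed

text \<open>Induction runs over a set of matrix indices rather than over the dimension: any index
  \<open>k\<close> outside \<open>I\<close> leaves room for one more orthogonal eigenvector, and
  \<open>I = UNIV\<close> yields a full basis indexed by the type itself.\<close>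

lemma exists_orthonormal_eigenvectors:
  fixes A :: "'m::finite cmat" and I :: "'m set"
  assumes "hermitian A"
  shows "\<exists>u d. \<forall>i\<in>I. A *v u i = d i *\<^sub>R u i \<and>
    (\<forall>j\<in>I. cinner (u i) (u j) = (if i = j then 1 else 0))"
proof -
  have "finite I" by simp
  then show ?thesis
  proof (induction I rule: finite_induct)
    case (insert k I)
    then obtain u d where "\<forall>i\<in>I. A *v u i = d i *\<^sub>R u i \<and>
        (\<forall>j\<in>I. cinner (u i) (u j) = (if i = j then 1 else 0))"
      by blast
    then have ud: "\<And>i. i \<in> I \<Longrightarrow> A *v u i = d i *\<^sub>R u i"
      "\<And>i j. i \<in> I \<Longrightarrow> j \<in> I \<Longrightarrow> cinner (u i) (u j) = (if i = j then 1 else 0)"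
      by blast+
    obtain x l where x: "norm x = 1" "A *v x = l *\<^sub>R x" "\<And>i. i \<in> I \<Longrightarrow> cinner (u i) x = 0"
      using exists_eigenvector_orthogonal[OF assms, of I u d k] ud insert(2) by blast
    have "cinner x x = 1" using x by (simp add: cinner_self norm_eq_1)
    moreover have "cinner x (u i) = 0" if "i \<in> I" for i
      using x(3)[OF that] cinner_commute[of x "u i"] by simp
    ultimately show ?case
      using ud x insert(2)
      by (intro exI[of _ "u(k := x)"] exI[of _ "d(k := l)"]) auto
  qed simp
qed

text \<open>For a fixed unitary \<open>U\<close> this is a functional calculus: products, multiples,
  differences and Loewner comparisons of such matrices become pointwise statements about the
  eigenvalues.\<close>

definition spec :: "'m::finite cmat \<Rightarrow> ('m \<Rightarrow> real) \<Rightarrow> 'm cmat"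
  where "spec U d = U ** diag_real d ** U\<^sup>\<dagger>"

lemma unitary_if_left: "U\<^sup>\<dagger> ** U = mat 1 \<Longrightarrow> unitary U"
  unfolding unitary_def using matrix_left_right_inverse[of U "U\<^sup>\<dagger>"] by simp

lemma diag_real_mult_nth: "(U ** diag_real d) $ i $ j = U $ i $ j * d j"
  by (simp add: matrix_matrix_mult_def diag_real_def if_distrib cong: if_cong)

lemma diag_real_mult_left_nth: "(diag_real d ** U) $ i $ j = d i * U $ i $ j"
  by (simp add: matrix_matrix_mult_def diag_real_def if_distrib if_distribR cong: if_cong)

theorem spectral_decomposition:
  fixes A :: "'m::finite cmat"
  assumes "hermitian A"
  obtains U d where "unitary U" "A = spec U d"
proof -
  obtain u :: "'m \<Rightarrow> complex ^ 'm" and d where "\<forall>i\<in>UNIV. A *v u i = d i *\<^sub>R u i \<and>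
      (\<forall>j\<in>UNIV. cinner (u i) (u j) = (if i = j then 1 else 0))"
    using exists_orthonormal_eigenvectors[OF assms, of UNIV] by blast
  then have ud: "\<And>i. A *v u i = d i *\<^sub>R u i"
    "\<And>i j. cinner (u i) (u j) = (if i = j then 1 else 0)"
    by blast+
  define U where "U = (\<chi> i j. u j $ i)"
  have "U\<^sup>\<dagger> ** U = mat 1"
    using ud(2) by (simp add: vec_eq_iff U_def matrix_matrix_mult_def mat_def cinner_def)
  then have U: "unitary U" by (rule unitary_if_left)
  have "A ** U = U ** diag_real d"
  proof -
    have "(A ** U) $ i $ j = (A *v u j) $ i" for i j
      by (simp add: U_def matrix_matrix_mult_def matrix_vector_mult_def)
    then show ?thesis
      by (simp add: vec_eq_iff ud diag_real_mult_nth) (simp add: U_def scaleR_conv_of_real)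
  qed
  then have "A ** (U ** U\<^sup>\<dagger>) = spec U d"
    by (simp add: spec_def matrix_mul_assoc)
  with U have "A = spec U d" by (simp add: unitary_def)
  with U show thesis by (rule that)
qed

section \<open>Real powers\<close>

lemma hermitian_spec: "hermitian (spec U d)"
proof -
  have "(diag_real d)\<^sup>\<dagger> = diag_real d"
    by (simp add: vec_eq_iff diag_real_def)
  then show ?thesis
    by (simp add: hermitian_def spec_def conj_transpose_mult matrix_mul_assoc)
qed

lemma spec_mult:
  assumes "unitary U"
  shows "spec U d ** spec U e = spec U (\<lambda>i. d i * e i)"
proof -
  have "spec U d ** spec U e = U ** (diag_real d ** (U\<^sup>\<dagger> ** U) ** diag_real e) ** U\<^sup>\<dagger>"
    by (simp only: spec_def matrix_mul_assoc)
  also have "diag_real d ** (U\<^sup>\<dagger> ** U) ** diag_real e = diag_real d ** diag_real e"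
    using assms by (simp add: unitary_def)
  also have "\<dots> = diag_real (\<lambda>i. d i * e i)"
    by (auto simp: vec_eq_iff diag_real_mult_nth) (auto simp: diag_real_def)
  finally show ?thesis by (simp add: spec_def)
qed

lemma spec_const:
  fixes U :: "'m::finite cmat"
  assumes "unitary U"
  shows "spec U (\<lambda>i. r) = r *\<^sub>R mat 1"
proof -
  have "(diag_real (\<lambda>i. r) :: 'm cmat) = r *\<^sub>R mat 1"
    by (auto simp: diag_real_def mat_def vec_eq_iff scaleR_conv_of_real[where 'a=complex])
  with assms show ?thesis
    by (simp add: spec_def unitary_def matrix_mult.scaleR_left matrix_mult.scaleR_right)
qed

lemma spec_one: "unitary U \<Longrightarrow> spec U (\<lambda>i. 1) = mat 1"
  using spec_const[of U 1] by simp

lemma spec_scaleR: "r *\<^sub>R spec U d = spec U (\<lambda>i. r * d i)"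
proof -
  have "diag_real (\<lambda>i. r * d i) = r *\<^sub>R diag_real d"
    by (auto simp: diag_real_def vec_eq_iff scaleR_conv_of_real[where 'a=complex])
  then show ?thesis
    by (simp add: spec_def matrix_mult.scaleR_left matrix_mult.scaleR_right)
qed

lemma diag_real_mult_vec_nth: "(diag_real d *v v) $ i = d i *\<^sub>R v $ i"
  by (simp add: matrix_vector_mult_def diag_real_def if_distrib if_distribR scaleR_conv_of_real[where 'a=complex] cong: if_cong)

lemma inner_spec: "v \<bullet> (spec U d *v v) = (\<Sum>i\<in>UNIV. d i * (cmod ((U\<^sup>\<dagger> *v v) $ i))\<^sup>2)"
proof -
  have "v \<bullet> (spec U d *v v) = (U\<^sup>\<dagger> *v v) \<bullet> (diag_real d *v (U\<^sup>\<dagger> *v v))"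
    by (simp only: spec_def matrix_vector_mul_assoc[symmetric] inner_matrix_vector_mult[of v U])
  then show ?thesis
    by (simp add: inner_vec_def diag_real_mult_vec_nth power2_norm_eq_inner)
qed

lemma unitary_norm_sum:
  assumes "unitary U"
  shows "(\<Sum>i\<in>UNIV. (cmod ((U\<^sup>\<dagger> *v v) $ i))\<^sup>2) = v \<bullet> v"
  using inner_spec[of v U "\<lambda>i. 1"] spec_one[OF assms] by simp

lemma spec_eigenvector:
  fixes U :: "'m::finite cmat"
  assumes "unitary U"
  shows "spec U d *v (U *v axis i 1) = d i *\<^sub>R (U *v axis i 1)" "U *v axis i 1 \<noteq> 0"
proof -
  have U: "U\<^sup>\<dagger> *v (U *v v) = v" for v
    using assms by (simp add: unitary_def matrix_vector_mul_assoc)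
  have "diag_real d *v axis i 1 = d i *\<^sub>R axis i 1"
    by (simp add: vec_eq_iff diag_real_mult_vec_nth axis_def)
  then show "spec U d *v (U *v axis i 1) = d i *\<^sub>R (U *v axis i 1)"
    by (simp only: spec_def matrix_vector_mul_assoc[symmetric] U matrix_vector_mult.scaleR_right)
  have "axis i (1 :: complex) \<noteq> 0" by (simp add: axis_eq_0_iff)
  then show "U *v axis i 1 \<noteq> 0"
    using U[of "axis i 1"] by auto
qed

section \<open>Positive definiteness in terms of eigenvalues\<close>

lemma pos_def_iff: "pos_def A \<longleftrightarrow> hermitian A \<and> (\<forall>v. v \<noteq> 0 \<longrightarrow> 0 < v \<bullet> (A *v v))"
  by (simp add: pos_def_def Re_quad_form)

lemma pos_semidef_iff: "pos_semidef A \<longleftrightarrow> hermitian A \<and> (\<forall>v. 0 \<le> v \<bullet> (A *v v))"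
  by (simp add: pos_semidef_def Re_quad_form)

lemma pos_def_imp_hermitian: "pos_def A \<Longrightarrow> hermitian A"
  by (simp add: pos_def_def)

lemma pos_def_imp_pos_semidef: "pos_def A \<Longrightarrow> pos_semidef A"
  unfolding pos_def_iff pos_semidef_iff by (metis inner_zero_left less_eq_real_def)

lemma conj_transpose_pos_def: "pos_def A \<Longrightarrow> A\<^sup>\<dagger> = A"
  by (simp add: pos_def_def hermitian_def)

lemma spec_eigenvalue_inner:
  assumes "unitary U"
  shows "(U *v axis i 1) \<bullet> (spec U d *v (U *v axis i 1)) = d i * ((U *v axis i 1) \<bullet> (U *v axis i 1))"
  by (simp add: spec_eigenvector[OF assms])

lemma pos_semidef_spec_iff:
  assumes "unitary U"
  shows "pos_semidef (spec U d) \<longleftrightarrow> (\<forall>i. 0 \<le> d i)"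
proof
  assume "pos_semidef (spec U d)"
  then have "0 \<le> d i * ((U *v axis i 1) \<bullet> (U *v axis i 1))" for i
    unfolding pos_semidef_iff spec_eigenvalue_inner[OF assms, symmetric] by blast
  moreover have "(U *v axis i 1) \<bullet> (U *v axis i 1) > 0" for i
    using spec_eigenvector(2)[OF assms] by simp
  ultimately show "\<forall>i. 0 \<le> d i"
    by (metis mult.commute zero_le_mult_iff not_less order_less_le)
next
  assume "\<forall>i. 0 \<le> d i"
  then show "pos_semidef (spec U d)"
    by (simp add: pos_semidef_iff hermitian_spec inner_spec sum_nonneg)
qed

lemma pos_def_spec_iff:
  assumes "unitary U"
  shows "pos_def (spec U d) \<longleftrightarrow> (\<forall>i. 0 < d i)"
proof
  assume "pos_def (spec U d)"
  then have "0 < d i * ((U *v axis i 1) \<bullet> (U *v axis i 1))" for i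
    using spec_eigenvector(2)[OF assms]
    unfolding pos_def_iff spec_eigenvalue_inner[OF assms, symmetric] by blast
  then show "\<forall>i. 0 < d i"
    by (metis inner_ge_zero zero_less_mult_pos2 mult_nonneg_nonpos2 not_less order_less_le
        mult_zero_right)
next
  assume d: "\<forall>i. 0 < d i"
  have "0 < v \<bullet> (spec U d *v v)" if "v \<noteq> 0" for v
  proof -
    have "(\<Sum>i\<in>UNIV. (cmod ((U\<^sup>\<dagger> *v v) $ i))\<^sup>2) \<noteq> 0"
      using that by (simp add: unitary_norm_sum[OF assms])
    then obtain i where i: "(cmod ((U\<^sup>\<dagger> *v v) $ i))\<^sup>2 \<noteq> 0"
      by (meson sum.not_neutral_contains_not_neutral)
    have "0 < d i * (cmod ((U\<^sup>\<dagger> *v v) $ i))\<^sup>2"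
      using d i by simp
    then show ?thesis
      unfolding inner_spec using d by (intro sum_pos2[of UNIV i]) (auto simp: less_imp_le)
  qed
  then show "pos_def (spec U d)"
    by (simp add: pos_def_iff hermitian_spec)
qed

lemma matrix_mult_cancel: "A ** B = mat 1 \<Longrightarrow> A ** (B ** C) = (C :: 'm::finite cmat)"
  by (simp add: matrix_mul_assoc)

text \<open>\<open>W = V\<^sup>* U\<close> satisfies \<open>W\<^sub>i\<^sub>j d\<^sub>j = e\<^sub>i W\<^sub>i\<^sub>j\<close>, so \<open>d\<^sub>j = e\<^sub>i\<close> wherever \<open>W\<^sub>i\<^sub>j \<noteq> 0\<close>.\<close>

lemma spec_eq_iff:
  fixes U V :: "'m::finite cmat"
  assumes U: "unitary U" and V: "unitary V"
  shows "spec U d = spec V e \<longleftrightarrow> (\<forall>i j. (V\<^sup>\<dagger> ** U) $ i $ j \<noteq> 0 \<longrightarrow> d j = e i)"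
proof -
  define W where "W = V\<^sup>\<dagger> ** U"
  have spec_W: "V\<^sup>\<dagger> ** spec U d ** U = W ** diag_real d" "V\<^sup>\<dagger> ** spec V e ** U = diag_real e ** W"
    using U V by (simp_all add: spec_def W_def unitary_def matrix_mul_assoc[symmetric] matrix_mult_cancel)
  have cancel: "V ** (V\<^sup>\<dagger> ** X ** U) ** U\<^sup>\<dagger> = X" for X
    using U V by (simp add: unitary_def matrix_mul_assoc[symmetric] matrix_mult_cancel)
  have "spec U d = spec V e \<longleftrightarrow> W ** diag_real d = diag_real e ** W"
    using spec_W cancel by metis
  also have "\<dots> \<longleftrightarrow> (\<forall>i j. W $ i $ j * d j = e i * W $ i $ j)"
    by (simp add: vec_eq_iff diag_real_mult_nth diag_real_mult_left_nth)
  also have "\<dots> \<longleftrightarrow> (\<forall>i j. W $ i $ j \<noteq> 0 \<longrightarrow> d j = e i)"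
    by (metis mult.commute mult_cancel_left of_real_eq_iff)
  finally show ?thesis by (simp add: W_def)
qed

text \<open>This discharges the definite description behind \<open>\<up>\<close>. Two
  diagonalisations of one matrix have equal eigenvalues wherever the overlap of their bases is
  nonzero; taking powers preserves these equalities, so the powers agree as well.\<close>

lemma mpow_spec:
  fixes U :: "'m::finite cmat"
  assumes U: "unitary U" and d: "\<forall>i. 0 < d i"
  shows "spec U d \<up> p = spec U (\<lambda>i. d i powr p)"
  unfolding mpow_def spec_def[symmetric]
proof (rule the_equality)
  show "\<exists>V e. unitary V \<and> (\<forall>i. 0 < e i) \<and> spec U d = spec V e \<and>
      spec U (\<lambda>i. d i powr p) = spec V (\<lambda>i. e i powr p)"
    using U d by blast
next
  fix B
  assume "\<exists>V e. unitary V \<and> (\<forall>i. 0 < e i) \<and> spec U d = spec V e \<and> B = spec V (\<lambda>i. e i powr p)"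
  then obtain V e where V: "unitary V" "spec U d = spec V e" "B = spec V (\<lambda>i. e i powr p)"
    by blast
  from V(2) have "spec U (\<lambda>i. d i powr p) = spec V (\<lambda>i. e i powr p)"
    unfolding spec_eq_iff[OF U V(1)] by metis
  with V(3) show "B = spec U (\<lambda>i. d i powr p)" by simp
qed

lemma pos_def_spectral:
  fixes A :: "'m::finite cmat"
  assumes "pos_def A"
  obtains U d where "unitary U" "\<forall>i. 0 < d i" "A = spec U d" "\<And>p. A \<up> p = spec U (\<lambda>i. d i powr p)"
proof -
  obtain U d where Ud: "unitary U" "A = spec U d"
    using spectral_decomposition pos_def_imp_hermitian assms by metis
  then have d: "\<forall>i. 0 < d i"
    using assms pos_def_spec_iff by metis
  show thesis
    by (rule that[OF Ud(1) d Ud(2)]) (simp add: Ud(2) mpow_spec[OF Ud(1) d])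
qed

lemma pos_def_mpow [simp]:
  assumes "pos_def A" shows "pos_def (A \<up> p)"
proof -
  obtain U d where "unitary U" "\<forall>i. 0 < d i" "A \<up> p = spec U (\<lambda>i. d i powr p)"
    using pos_def_spectral[OF assms] by metis
  then show ?thesis by (simp add: pos_def_spec_iff order_less_imp_not_eq2)
qed

lemma conj_transpose_mpow [simp]: "pos_def A \<Longrightarrow> (A \<up> p)\<^sup>\<dagger> = A \<up> p"
  by (simp add: conj_transpose_pos_def)

lemma mpow_add:
  assumes "pos_def A" shows "A \<up> p ** A \<up> q = A \<up> (p + q)"
proof -
  obtain U d where "unitary U" "\<forall>i. 0 < d i" "\<And>p. A \<up> p = spec U (\<lambda>i. d i powr p)"
    using pos_def_spectral[OF assms] by metis
  then show ?thesis by (simp add: spec_mult powr_add)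
qed

lemma mpow_mpow:
  assumes "pos_def A" shows "(A \<up> p) \<up> q = A \<up> (p * q)"
proof -
  obtain U d where "unitary U" "\<forall>i. 0 < d i" "\<And>p. A \<up> p = spec U (\<lambda>i. d i powr p)"
    using pos_def_spectral[OF assms] by metis
  then show ?thesis by (simp add: mpow_spec powr_powr order_less_imp_not_eq2)
qed

lemma mpow_1 [simp]:
  assumes "pos_def A" shows "A \<up> 1 = A"
proof -
  obtain U d where "unitary U" "\<forall>i. 0 < d i" "A = spec U d" "\<And>p. A \<up> p = spec U (\<lambda>i. d i powr p)"
    using pos_def_spectral[OF assms] by metis
  then show ?thesis by (simp add: less_imp_le)
qed

lemma mpow_0 [simp]:
  assumes "pos_def A" shows "A \<up> 0 = mat 1"
proof -
  obtain U d where Ud: "unitary U" "\<forall>i. 0 < d i" "\<And>p. A \<up> p = spec U (\<lambda>i. d i powr p)"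
    using pos_def_spectral[OF assms] by metis
  have "d i \<noteq> 0" for i using Ud(2) by (metis less_irrefl)
  then show ?thesis using Ud by (simp add: spec_one)
qed

lemma mpow_scaleR:
  assumes "pos_def A" "0 < r" shows "(r *\<^sub>R A) \<up> p = (r powr p) *\<^sub>R A \<up> p"
proof -
  obtain U d where "unitary U" "\<forall>i. 0 < d i" "A = spec U d" "\<And>p. A \<up> p = spec U (\<lambda>i. d i powr p)"
    using pos_def_spectral[OF assms(1)] by metis
  then show ?thesis
    using assms(2) by (simp add: spec_scaleR mpow_spec powr_mult less_imp_le)
qed

lemma mpow_mult_minus [simp]:
  assumes "pos_def A"
  shows "A \<up> p ** A \<up> (- p) = mat 1" "A \<up> (- p) ** A \<up> p = mat 1"
  using assms by (simp_all add: mpow_add)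

lemma mpow_cancel [simp]:
  fixes A B :: "'m::finite cmat"
  assumes "pos_def A"
  shows "A \<up> p ** (A \<up> (- p) ** B) = B" "A \<up> (- p) ** (A \<up> p ** B) = B"
  using assms by (simp_all add: matrix_mult_cancel)

lemma mpow_add_left:
  "pos_def A \<Longrightarrow> A \<up> p ** (A \<up> q ** (B :: 'm::finite cmat)) = A \<up> (p + q) ** B"
  by (simp add: matrix_mul_assoc mpow_add)

lemma mpow_half_sq:
  assumes "pos_def A" shows "A \<up> (1 / 2) ** A \<up> (1 / 2) = A"
  using assms by (simp add: mpow_add)

text \<open>Since \<open>M\<close> is the real power \<open>N \<up> 2\<close>, composing exponents
  already gives uniqueness of the positive square root.\<close>

lemma mpow_square_unique:
  assumes "pos_def N" "N ** N = M" shows "N = M \<up> (1 / 2)"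
proof -
  have "M = N \<up> 2"
    using assms mpow_add[of N 1 1] by simp
  with assms show ?thesis by (simp add: mpow_mpow)
qed

section \<open>The Loewner order\<close>

lemma hermitian_add: "hermitian A \<Longrightarrow> hermitian B \<Longrightarrow> hermitian (A + B)"
  by (simp add: hermitian_def conj_transpose_add)

lemma hermitian_diff: "hermitian A \<Longrightarrow> hermitian B \<Longrightarrow> hermitian (A - B)"
  by (simp add: hermitian_def conj_transpose_diff)

lemma hermitian_scaleR: "hermitian A \<Longrightarrow> hermitian (r *\<^sub>R A)"
  by (simp add: hermitian_def conj_transpose_scaleR)

lemma hermitian_mat_1: "hermitian (mat 1)"
  by (simp add: hermitian_def)

lemma hermitian_hadamard: "hermitian A \<Longrightarrow> hermitian B \<Longrightarrow> hermitian (A \<odot> B)"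
  by (simp add: hermitian_def vec_eq_iff hadamard_def)

lemma hermitian_congruence: "hermitian A \<Longrightarrow> hermitian (K\<^sup>\<dagger> ** A ** K)"
  by (simp add: hermitian_def conj_transpose_mult matrix_mul_assoc)

lemma inner_congruence: "v \<bullet> ((K\<^sup>\<dagger> ** A ** K) *v v) = (K *v v) \<bullet> (A *v (K *v v))"
  by (simp only: matrix_vector_mul_assoc[symmetric] inner_matrix_vector_mult[of v "K\<^sup>\<dagger>"]
      conj_transpose_conj_transpose)

lemma pos_semidef_add: "pos_semidef A \<Longrightarrow> pos_semidef B \<Longrightarrow> pos_semidef (A + B)"
  by (simp add: pos_semidef_iff hermitian_add matrix_vector_mult.add_left inner_add_right)

lemma pos_semidef_scaleR: "pos_semidef A \<Longrightarrow> 0 \<le> r \<Longrightarrow> pos_semidef (r *\<^sub>R A)"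
  by (simp add: pos_semidef_iff hermitian_scaleR matrix_vector_mult.scaleR_left)

lemma pos_def_scaleR: "pos_def A \<Longrightarrow> 0 < r \<Longrightarrow> pos_def (r *\<^sub>R A)"
  by (simp add: pos_def_iff hermitian_scaleR matrix_vector_mult.scaleR_left)

lemma pos_def_add: "pos_def A \<Longrightarrow> pos_semidef B \<Longrightarrow> pos_def (A + B)"
  by (simp add: pos_semidef_iff pos_def_iff hermitian_add matrix_vector_mult.add_left
      inner_add_right add_pos_nonneg)

lemma pos_def_mat_1 [simp]: "pos_def (mat 1)"
  by (simp add: pos_def_iff hermitian_mat_1)

lemma pos_def_congruence:
  assumes "pos_def A" "L ** K = mat 1" shows "pos_def (K\<^sup>\<dagger> ** A ** K)"
proof -
  have "K *v v \<noteq> 0" if "v \<noteq> 0" for v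
    using that assms(2) by (metis matrix_vector_mul_assoc matrix_vector_mul_lid matrix_vector_mult_0_right)
  with assms(1) show ?thesis
    by (simp add: pos_def_iff hermitian_congruence inner_congruence)
qed

lemma pos_def_mpow_congruence [simp]:
  assumes "pos_def A" "pos_def B" shows "pos_def (A \<up> p ** B ** A \<up> p)"
  using pos_def_congruence[OF assms(2), of "A \<up> (- p)" "A \<up> p"] assms(1) by simp

lemma pos_semidef_zero: "pos_semidef 0"
  by (simp add: pos_semidef_iff hermitian_def vec_eq_iff)

lemma pos_semidef_sum: "(\<And>i. i \<in> I \<Longrightarrow> pos_semidef (A i)) \<Longrightarrow> pos_semidef (sum A I)"
  by (induction I rule: infinite_finite_induct) (auto intro: pos_semidef_add pos_semidef_zero)

lemma pos_def_weighted_sum: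
  fixes A :: "'i::finite \<Rightarrow> 'm::finite cmat"
  assumes "\<And>i. 0 < w i" "\<And>i. pos_def (A i)"
  shows "pos_def (\<Sum>i\<in>UNIV. w i *\<^sub>R A i)"
proof -
  \<comment> \<open>Types are nonempty, so some index exists; its summand is positive definite and
    the remaining ones only have to be semidefinite.\<close>
  obtain k :: 'i where True by simp
  have "(\<Sum>i\<in>UNIV. w i *\<^sub>R A i) = w k *\<^sub>R A k + (\<Sum>i\<in>UNIV - {k}. w i *\<^sub>R A i)"
    by (simp add: sum.remove)
  also have "pos_def \<dots>"
    using assms
    by (intro pos_def_add pos_def_scaleR pos_semidef_sum pos_semidef_scaleR pos_def_imp_pos_semidef)
      (auto intro: less_imp_le)
  finally show ?thesis .
qed

lemma loewner_le_inner: "A \<le>\<^sub>L B \<Longrightarrow> v \<bullet> (A *v v) \<le> v \<bullet> (B *v v)"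
  by (simp add: loewner_le_def pos_semidef_iff matrix_vector_mult.diff_left inner_diff_right)

lemma loewner_leI:
  "hermitian A \<Longrightarrow> hermitian B \<Longrightarrow> (\<And>v. v \<bullet> (A *v v) \<le> v \<bullet> (B *v v)) \<Longrightarrow> A \<le>\<^sub>L B"
  by (simp add: loewner_le_def pos_semidef_iff matrix_vector_mult.diff_left inner_diff_right hermitian_diff)

lemma loewner_le_iff:
  "hermitian A \<Longrightarrow> hermitian B \<Longrightarrow> A \<le>\<^sub>L B \<longleftrightarrow> (\<forall>v. v \<bullet> (A *v v) \<le> v \<bullet> (B *v v))"
  using loewner_le_inner loewner_leI by blast

lemma loewner_le_refl [simp]: "A \<le>\<^sub>L A"
  by (simp add: loewner_le_def pos_semidef_zero)

lemma loewner_le_trans [trans]: "A \<le>\<^sub>L B \<Longrightarrow> B \<le>\<^sub>L C \<Longrightarrow> A \<le>\<^sub>L C"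
  unfolding loewner_le_def using pos_semidef_add[of "B - A" "C - B"] by simp

lemma loewner_le_antisym:
  assumes "A \<le>\<^sub>L B" "B \<le>\<^sub>L A" shows "A = B"
proof -
  obtain U d where U: "unitary U" "B - A = spec U d"
    using assms(1) spectral_decomposition unfolding loewner_le_def pos_semidef_def by metis
  have "A - B = spec U (\<lambda>i. - d i)"
    using U(2) spec_scaleR[of "-1" U d] by (simp add: minus_diff_eq[of B A, symmetric] del: minus_diff_eq)
  then have "d i = 0" for i
    using assms U pos_semidef_spec_iff[OF U(1)]
    unfolding loewner_le_def by (metis neg_0_le_iff_le order_antisym)
  then have "d = (\<lambda>i. 0)" by (rule ext)
  then show ?thesis
    using U(2) spec_const[OF U(1), of 0] by simp
qed

lemma loewner_le_add: "A \<le>\<^sub>L B \<Longrightarrow> C \<le>\<^sub>L D \<Longrightarrow> A + C \<le>\<^sub>L B + D"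
  unfolding loewner_le_def using pos_semidef_add[of "B - A" "D - C"] by (simp add: algebra_simps)

lemma loewner_le_scaleR: "A \<le>\<^sub>L B \<Longrightarrow> 0 \<le> r \<Longrightarrow> r *\<^sub>R A \<le>\<^sub>L r *\<^sub>R B"
  unfolding loewner_le_def using pos_semidef_scaleR[of "B - A" r] by (simp add: scaleR_diff_right)

lemma loewner_le_sum: "(\<And>i. i \<in> I \<Longrightarrow> A i \<le>\<^sub>L B i) \<Longrightarrow> sum A I \<le>\<^sub>L sum B I"
  unfolding loewner_le_def using pos_semidef_sum[of I "\<lambda>i. B i - A i"] by (simp add: sum_subtractf)

lemma pos_def_loewner_le:
  assumes "pos_def A" "A \<le>\<^sub>L B" shows "pos_def B"
  using pos_def_add[of A "B - A"] assms by (simp add: loewner_le_def)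

lemma loewner_le_congruence:
  assumes "A \<le>\<^sub>L B" shows "K\<^sup>\<dagger> ** A ** K \<le>\<^sub>L K\<^sup>\<dagger> ** B ** K"
proof -
  have "K\<^sup>\<dagger> ** B ** K - K\<^sup>\<dagger> ** A ** K = K\<^sup>\<dagger> ** (B - A) ** K"
    by (simp add: matrix_mult.diff_left matrix_mult.diff_right)
  with assms show ?thesis
    by (simp add: loewner_le_def pos_semidef_iff hermitian_congruence inner_congruence)
qed

lemma spec_diff: "spec U d - spec U e = spec U (\<lambda>i. d i - e i)"
proof -
  have "diag_real (\<lambda>i. d i - e i) = diag_real d - diag_real e"
    by (auto simp: diag_real_def vec_eq_iff)
  then show ?thesis
    by (simp add: spec_def matrix_mult.diff_left matrix_mult.diff_right)
qed

lemma loewner_le_spec_iff: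
  "unitary U \<Longrightarrow> spec U d \<le>\<^sub>L spec U e \<longleftrightarrow> (\<forall>i. d i \<le> e i)"
  by (simp add: loewner_le_def spec_diff pos_semidef_spec_iff)

lemma mat_loewner_le_spec_iff:
  assumes "unitary U"
  shows "r *\<^sub>R mat 1 \<le>\<^sub>L spec U d \<longleftrightarrow> (\<forall>i. r \<le> d i)" "spec U d \<le>\<^sub>L r *\<^sub>R mat 1 \<longleftrightarrow> (\<forall>i. d i \<le> r)"
  using loewner_le_spec_iff[OF assms] by (simp_all flip: spec_const[OF assms])

text \<open>Comparison with a multiple of the identity only concerns eigenvalues and therefore
  survives every nonnegative power, whereas a general Loewner inequality does not survive powers
  above 1.\<close>

lemma mat_loewner_le_mpow:
  assumes "pos_def A" "r *\<^sub>R mat 1 \<le>\<^sub>L A" "0 \<le> r" "0 \<le> p"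
  shows "(r powr p) *\<^sub>R mat 1 \<le>\<^sub>L A \<up> p"
proof -
  obtain U d where "unitary U" "\<forall>i. 0 < d i" "A = spec U d" "\<And>p. A \<up> p = spec U (\<lambda>i. d i powr p)"
    using pos_def_spectral[OF assms(1)] by metis
  with assms show ?thesis by (simp add: mat_loewner_le_spec_iff powr_mono2)
qed

lemma mpow_loewner_le_mat:
  assumes "pos_def A" "A \<le>\<^sub>L r *\<^sub>R mat 1" "0 \<le> p"
  shows "A \<up> p \<le>\<^sub>L (r powr p) *\<^sub>R mat 1"
proof -
  obtain U d where "unitary U" "\<forall>i. 0 < d i" "A = spec U d" "\<And>p. A \<up> p = spec U (\<lambda>i. d i powr p)"
    using pos_def_spectral[OF assms(1)] by metis
  with assms show ?thesis by (simp add: mat_loewner_le_spec_iff powr_mono2 less_imp_le)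
qed

lemma mpow_mono_exponent:
  assumes "pos_def A" "mat 1 \<le>\<^sub>L A" "p \<le> q"
  shows "A \<up> p \<le>\<^sub>L A \<up> q"
proof -
  obtain U d where Ud: "unitary U" "\<forall>i. 0 < d i" "A = spec U d" "\<And>p. A \<up> p = spec U (\<lambda>i. d i powr p)"
    using pos_def_spectral[OF assms(1)] by metis
  then have "\<forall>i. 1 \<le> d i"
    using assms(2) mat_loewner_le_spec_iff(1)[OF Ud(1), of 1 d] by simp
  with Ud assms(3) show ?thesis by (simp add: loewner_le_spec_iff powr_mono)
qed

lemma pos_def_bounds:
  fixes A :: "'m::finite cmat"
  assumes "pos_def A"
  obtains a b where "0 < a" "a *\<^sub>R mat 1 \<le>\<^sub>L A" "A \<le>\<^sub>L b *\<^sub>R mat 1"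
proof -
  obtain U d where Ud: "unitary U" "\<forall>i. 0 < d i" "A = spec U d"
    using pos_def_spectral[OF assms] by metis
  have "0 < Min (range d)" using Ud(2) by simp
  with Ud show thesis
    by (intro that[of "Min (range d)" "Max (range d)"]) (simp_all add: mat_loewner_le_spec_iff)
qed

text \<open>A congruence by \<open>A \<up> (- (1/2))\<close> turns the generalised eigenvalue
  problem of the pair \<open>H\<close>, \<open>A\<close> into an ordinary one. The metric
  \<open>A\<close> is the one in which the extremal property of the geometric mean is easy to
  test.\<close>

lemma pos_semidef_if_eigenvalues:
  assumes H: "hermitian H" and A: "pos_def A"
    and eig: "\<And>v l. v \<noteq> 0 \<Longrightarrow> H *v v = l *\<^sub>R (A *v v) \<Longrightarrow> 0 \<le> l"
  shows "pos_semidef H"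
proof -
  define N where "N = A \<up> (- (1/2))"
  define P where "P = A \<up> (1/2)"
  have NP: "N\<^sup>\<dagger> = N" "P\<^sup>\<dagger> = P" "N ** P = mat 1" "P ** N = mat 1" "P ** P = A"
    using A mpow_half_sq[OF A] by (simp_all add: N_def P_def)
  have "hermitian (N ** H ** N)"
    using hermitian_congruence[OF H, of N] NP by simp
  then obtain U d where Ud: "unitary U" "N ** H ** N = spec U d"
    by (rule spectral_decomposition)
  have H_eq: "P ** (N ** H ** N) ** P = H"
    using NP by (simp add: matrix_mul_assoc[symmetric] matrix_mult_cancel)
  have "0 \<le> d i" for i
  proof (rule eig)
    let ?x = "U *v axis i 1"
    have "P *v (N *v ?x) = ?x"
      by (simp only: matrix_vector_mul_assoc matrix_mul_assoc NP(4) matrix_mul_lid)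
    then show "N *v ?x \<noteq> 0"
      using spec_eigenvector(2)[OF Ud(1), of i] by auto
    have "H *v (N *v ?x) = P *v (spec U d *v (P *v (N *v ?x)))"
      by (subst H_eq[symmetric]) (simp only: Ud(2) matrix_vector_mul_assoc matrix_mul_assoc)
    also have "\<dots> = d i *\<^sub>R (P *v ?x)"
      by (simp only: \<open>P *v (N *v ?x) = ?x\<close> spec_eigenvector(1)[OF Ud(1)] matrix_vector_mult.scaleR_right)
    also have "P *v ?x = A *v (N *v ?x)"
      by (simp only: NP(5)[symmetric] matrix_vector_mul_assoc[symmetric] \<open>P *v (N *v ?x) = ?x\<close>)
    finally show "H *v (N *v ?x) = d i *\<^sub>R (A *v (N *v ?x))" .
  qed
  then have "pos_semidef (N ** H ** N)"
    by (simp add: Ud pos_semidef_spec_iff)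
  then have "pos_semidef (P\<^sup>\<dagger> ** (N ** H ** N) ** P)"
    by (simp add: pos_semidef_iff hermitian_congruence inner_congruence)
  then show ?thesis
    using H_eq NP by simp
qed

lemma pos_semidef_factor:
  assumes "pos_semidef A"
  obtains P where "A = P ** P\<^sup>\<dagger>"
proof -
  obtain U d where U: "unitary U" "A = spec U d"
    using assms spectral_decomposition unfolding pos_semidef_def by metis
  then have "\<forall>i. 0 \<le> d i"
    using assms pos_semidef_spec_iff by blast
  then have "A = spec U (\<lambda>i. sqrt (d i)) ** (spec U (\<lambda>i. sqrt (d i)))\<^sup>\<dagger>"
    using U hermitian_spec[of U "\<lambda>i. sqrt (d i)"] by (simp add: hermitian_def spec_mult)
  then show thesis by (rule that)
qed

section \<open>Hadamard products\<close>

lemma sum_swap4: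
  "(\<Sum>i\<in>A. \<Sum>j\<in>B. \<Sum>k\<in>C. \<Sum>l\<in>D. T i j k l) = (\<Sum>k\<in>C. \<Sum>l\<in>D. \<Sum>i\<in>A. \<Sum>j\<in>B. T i j k l)"
proof -
  have "(\<Sum>i\<in>A. \<Sum>j\<in>B. \<Sum>k\<in>C. \<Sum>l\<in>D. T i j k l) = (\<Sum>i\<in>A. \<Sum>k\<in>C. \<Sum>j\<in>B. \<Sum>l\<in>D. T i j k l)"
    by (intro sum.cong refl) (rule sum.swap)
  also have "\<dots> = (\<Sum>k\<in>C. \<Sum>i\<in>A. \<Sum>j\<in>B. \<Sum>l\<in>D. T i j k l)"
    by (rule sum.swap)
  also have "\<dots> = (\<Sum>k\<in>C. \<Sum>i\<in>A. \<Sum>l\<in>D. \<Sum>j\<in>B. T i j k l)"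
    by (intro sum.cong refl) (rule sum.swap)
  also have "\<dots> = (\<Sum>k\<in>C. \<Sum>l\<in>D. \<Sum>i\<in>A. \<Sum>j\<in>B. T i j k l)"
    by (intro sum.cong refl) (rule sum.swap)
  finally show ?thesis .
qed

text \<open>The inner product of \<open>v\<close> with the entrywise product of column
  \<open>k\<close> of \<open>P\<close> and column \<open>l\<close> of \<open>Q\<close>.\<close>

definition gram_coeff :: "'m::finite cmat \<Rightarrow> 'm cmat \<Rightarrow> complex ^ 'm \<Rightarrow> 'm \<Rightarrow> 'm \<Rightarrow> complex"
  where "gram_coeff P Q v k l = (\<Sum>i\<in>UNIV. cnj (P $ i $ k * Q $ i $ l) * v $ i)"

text \<open>This is the computation behind the Schur product theorem: a Hadamard product of two
  matrix products is a Gram sum over pairs of columns. Allowing different left and right factors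
  makes it cover the off-diagonal blocks needed in \<open>geom_half_hadamard\<close> too.\<close>

lemma inner_hadamard_gram:
  "u \<bullet> (((P ** R\<^sup>\<dagger>) \<odot> (Q ** S\<^sup>\<dagger>)) *v v) =
    (\<Sum>k\<in>UNIV. \<Sum>l\<in>UNIV. gram_coeff P Q u k l \<bullet> gram_coeff R S v k l)"
proof -
  define T where "T i j k l = cnj (u $ i) * ((P $ i $ k * cnj (R $ j $ k)) * (Q $ i $ l * cnj (S $ j $ l))) * v $ j" for i j k l
  have "cinner u (((P ** R\<^sup>\<dagger>) \<odot> (Q ** S\<^sup>\<dagger>)) *v v) = (\<Sum>i\<in>UNIV. \<Sum>j\<in>UNIV. \<Sum>k\<in>UNIV. \<Sum>l\<in>UNIV. T i j k l)"
    by (simp add: cinner_def matrix_vector_mult_def hadamard_def matrix_matrix_mult_def T_def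
        sum_product) (simp add: sum_distrib_left sum_distrib_right mult.assoc)
  also have "\<dots> = (\<Sum>k\<in>UNIV. \<Sum>l\<in>UNIV. \<Sum>i\<in>UNIV. \<Sum>j\<in>UNIV. T i j k l)"
    by (rule sum_swap4)
  also have "\<dots> = (\<Sum>k\<in>UNIV. \<Sum>l\<in>UNIV. cnj (gram_coeff P Q u k l) * gram_coeff R S v k l)"
    unfolding gram_coeff_def cnj_sum sum_product
    by (intro sum.cong refl) (simp add: T_def mult_ac)
  finally have "Re (cinner u (((P ** R\<^sup>\<dagger>) \<odot> (Q ** S\<^sup>\<dagger>)) *v v)) = Re \<dots>"
    by simp
  then show ?thesis
    by (simp add: Re_cinner inner_complex_def)
qed

lemma pos_semidef_hadamard:
  assumes "pos_semidef A" "pos_semidef B" shows "pos_semidef (A \<odot> B)"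
proof -
  obtain P Q where "A = P ** P\<^sup>\<dagger>" "B = Q ** Q\<^sup>\<dagger>"
    using pos_semidef_factor assms by metis
  then have "0 \<le> v \<bullet> ((A \<odot> B) *v v)" for v
    by (simp add: inner_hadamard_gram sum_nonneg)
  with assms show ?thesis
    by (simp add: pos_semidef_iff hermitian_hadamard)
qed

text \<open>The difference telescopes into two Hadamard products of semidefinite matrices; the
  chosen telescoping keeps \<open>B\<close> and \<open>C\<close> as the undifferenced
  factors.\<close>

lemma hadamard_mono:
  assumes "A \<le>\<^sub>L B" "C \<le>\<^sub>L D" "pos_semidef B" "pos_semidef C"
  shows "A \<odot> C \<le>\<^sub>L B \<odot> D"
proof -
  have "B \<odot> D - A \<odot> C = (B - A) \<odot> C + B \<odot> (D - C)"
    by (simp add: hadamard.diff_left hadamard.diff_right)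
  with assms show ?thesis
    by (simp add: loewner_le_def pos_semidef_add pos_semidef_hadamard)
qed

text \<open>Strictness comes from scalar lower bounds: the Hadamard product of two positive
  multiples of the identity is again such a multiple.\<close>

lemma pos_def_hadamard:
  fixes A B :: "'m::finite cmat"
  assumes "pos_def A" "pos_def B" shows "pos_def (A \<odot> B)"
proof -
  obtain a b where ab: "0 < a" "a *\<^sub>R mat 1 \<le>\<^sub>L A" "0 < b" "b *\<^sub>R mat 1 \<le>\<^sub>L B"
    using pos_def_bounds assms by metis
  have "(a *\<^sub>R mat 1) \<odot> (b *\<^sub>R mat 1) \<le>\<^sub>L A \<odot> B"
    using ab assms by (intro hadamard_mono pos_def_imp_pos_semidef pos_def_scaleR) auto
  moreover have "mat 1 \<odot> mat 1 = (mat 1 :: 'm cmat)"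
    by (simp add: vec_eq_iff hadamard_def mat_def)
  then have "pos_def ((a *\<^sub>R mat 1) \<odot> (b *\<^sub>R mat 1) :: 'm cmat)"
    using ab by (simp add: hadamard.scaleR_left hadamard.scaleR_right pos_def_scaleR)
  ultimately show ?thesis
    by (rule pos_def_loewner_le[rotated])
qed

section \<open>Weighted geometric means\<close>

text \<open>The exponent \<open>- 1 / 2\<close> is brought into the shape \<open>- (1/2)\<close>
  that the cancellation rules for \<open>A \<up> (- p)\<close> match.\<close>

lemma geom_mean_eq:
  "geom_mean t A B = A \<up> (1/2) ** (A \<up> (- (1/2)) ** B ** A \<up> (- (1/2))) \<up> t ** A \<up> (1/2)"
  by (simp add: geom_mean_def)

lemma pos_def_geom_mean [simp]: "pos_def A \<Longrightarrow> pos_def B \<Longrightarrow> pos_def (geom_mean t A B)"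
  by (simp add: geom_mean_eq)

lemma mpow_minus_1_unique:
  assumes "pos_def A" "A ** B = mat 1" shows "A \<up> (- 1) = B"
proof -
  have "B = A \<up> (- 1) ** (A \<up> 1 ** B)"
    using assms(1) mpow_cancel(2)[OF assms(1), of 1 B] by simp
  with assms show ?thesis by simp
qed

lemma geom_mean_0 [simp]: "pos_def A \<Longrightarrow> pos_def B \<Longrightarrow> geom_mean 0 A B = A"
  by (simp add: geom_mean_eq mpow_half_sq)

lemma geom_mean_1 [simp]:
  assumes "pos_def A" "pos_def B" shows "geom_mean 1 A B = B"
proof -
  have "(A \<up> (- (1/2)) ** B ** A \<up> (- (1/2))) \<up> 1 = A \<up> (- (1/2)) ** B ** A \<up> (- (1/2))"
    using assms by simp
  with assms show ?thesis
    by (simp add: geom_mean_eq matrix_mul_assoc[symmetric])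
qed

lemma geom_mean_self [simp]:
  assumes "pos_def A" shows "geom_mean t A A = A"
proof -
  have "A \<up> (- (1/2)) ** A \<up> 1 ** A \<up> (- (1/2)) = mat 1"
    using assms by (simp only: mpow_add) simp
  moreover have "mat 1 \<up> t = (mat 1 :: 'a cmat)"
    using mpow_mpow[of "mat 1 :: 'a cmat" 0 t] by simp
  ultimately show ?thesis
    using assms by (simp add: geom_mean_eq mpow_half_sq)
qed

text \<open>For \<open>t > 0\<close> the degree is below 1, so iteration drives a factor
  \<open>r\<close> towards 1; the comparison of sub- and supersolutions rests on this.\<close>

lemma geom_mean_scaleR_left:
  assumes "pos_def A" "pos_def B" "0 < r"
  shows "geom_mean t (r *\<^sub>R A) B = (r powr (1 - t)) *\<^sub>R geom_mean t A B"
proof -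
  have "geom_mean t (r *\<^sub>R A) B =
      (r powr (1/2) * (r powr (- (1/2)) * r powr (- (1/2))) powr t * r powr (1/2)) *\<^sub>R geom_mean t A B"
    using assms by (simp add: geom_mean_eq mpow_scaleR matrix_mult.scaleR_left matrix_mult.scaleR_right mult_ac)
  also have "r powr (1/2) * (r powr (- (1/2)) * r powr (- (1/2))) powr t * r powr (1/2) = r powr (1 - t)"
    by (simp only: powr_add[symmetric] powr_powr) simp
  finally show ?thesis .
qed

text \<open>Congruence by \<open>A \<up> (- (1/2))\<close> turns the Riccati equation into
  \<open>N ** N = M\<close>, whose positive solution is the square root of \<open>M\<close>.\<close>

lemma geom_half_unique:
  assumes A: "pos_def A" and G: "pos_def G" and eq: "G ** A \<up> (- 1) ** G = B"
  shows "geom_mean (1/2) A B = G"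
proof -
  define N where "N = A \<up> (- (1/2)) ** G ** A \<up> (- (1/2))"
  have "N ** N = A \<up> (- (1/2)) ** B ** A \<up> (- (1/2))"
    using A by (simp add: N_def eq[symmetric] matrix_mul_assoc[symmetric] mpow_add_left)
  moreover have "pos_def N"
    using A G by (simp add: N_def)
  ultimately have "N = (A \<up> (- (1/2)) ** B ** A \<up> (- (1/2))) \<up> (1/2)"
    by (metis mpow_square_unique)
  then have "geom_mean (1/2) A B = A \<up> (1/2) ** N ** A \<up> (1/2)"
    by (simp add: geom_mean_eq)
  also have "\<dots> = G"
    using A by (simp add: N_def matrix_mul_assoc[symmetric])
  finally show ?thesis .
qed

text \<open>All means of \<open>A\<close> and \<open>B\<close> are congruent, through
  \<open>A \<up> (1/2)\<close>, to powers of the same matrix \<open>M\<close>, so the product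
  collapses to the exponent \<open>u + (u - s) = t\<close>. Special cases are the midpoint rule and
  the Riccati equation of the unweighted mean.\<close>

lemma geom_mean_riccati:
  fixes A B :: "'m::finite cmat"
  assumes A: "pos_def A" and B: "pos_def B" and u: "2 * u = s + t"
  shows "geom_mean u A B ** geom_mean s A B \<up> (- 1) ** geom_mean u A B = geom_mean t A B"
proof -
  define M where "M = A \<up> (- (1/2)) ** B ** A \<up> (- (1/2))"
  have M: "pos_def M" using A B by (simp add: M_def)
  have G: "geom_mean t A B = A \<up> (1/2) ** M \<up> t ** A \<up> (1/2)" for t
    by (simp add: geom_mean_eq M_def)
  have "geom_mean s A B ** (A \<up> (- (1/2)) ** M \<up> (- s) ** A \<up> (- (1/2))) = mat 1"
    using A M by (simp add: G matrix_mul_assoc[symmetric])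
  then have "geom_mean s A B \<up> (- 1) = A \<up> (- (1/2)) ** M \<up> (- s) ** A \<up> (- (1/2))"
    using A B by (intro mpow_minus_1_unique) auto
  moreover have "u + (u - s) = t" using u by simp
  ultimately show ?thesis
    using A M by (simp add: G matrix_mul_assoc[symmetric] mpow_add_left)
qed

lemma geom_mean_midpoint:
  assumes "pos_def A" "pos_def B"
  shows "geom_mean ((s + t) / 2) A B = geom_mean (1/2) (geom_mean s A B) (geom_mean t A B)"
  using assms geom_mean_riccati[OF assms, of "(s + t) / 2" s t]
  by (intro geom_half_unique[symmetric]) auto

lemma geom_half_riccati:
  assumes "pos_def A" "pos_def B"
  shows "geom_mean (1/2) A B ** A \<up> (- 1) ** geom_mean (1/2) A B = B"
  using geom_mean_riccati[OF assms, of "1/2" 0 1] assms by simp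

text \<open>The feasibility half of Ando's characterisation: the block matrix with diagonal
  \<open>A\<close>, \<open>B\<close> and off-diagonal mean is the Gram matrix of the stacked factors
  \<open>P\<close> and \<open>R\<close>. The factored form is kept because it combines with Hadamard
  products.\<close>

lemma geom_half_factor:
  assumes A: "pos_def A" and B: "pos_def B"
  obtains P R where "A = P ** P\<^sup>\<dagger>" "B = R ** R\<^sup>\<dagger>" "geom_mean (1/2) A B = P ** R\<^sup>\<dagger>"
proof
  let ?G = "geom_mean (1/2) A B"
  show "A = A \<up> (1/2) ** (A \<up> (1/2))\<^sup>\<dagger>"
    using A by (simp add: mpow_half_sq)
  have G: "?G\<^sup>\<dagger> = ?G"
    using A B by (simp add: conj_transpose_pos_def)
  show "B = (?G ** A \<up> (- (1/2))) ** (?G ** A \<up> (- (1/2)))\<^sup>\<dagger>"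
    using A geom_half_riccati[OF A B]
    by (simp add: conj_transpose_mult G matrix_mul_assoc[symmetric] mpow_add_left)
  show "?G = A \<up> (1/2) ** (?G ** A \<up> (- (1/2)))\<^sup>\<dagger>"
    using A by (simp add: conj_transpose_mult G)
qed

text \<open>The maximality half of Ando's characterisation: \<open>A # B\<close> is the largest Hermitian \<open>X\<close> for which
  the block matrix with diagonal \<open>A, B\<close> and off-diagonal \<open>X\<close> is positive semidefinite.\<close>

lemma geom_half_max:
  assumes A: "pos_def A" and B: "pos_def B" and X: "hermitian X"
    and block: "\<And>u v. 0 \<le> u \<bullet> (A *v u) + v \<bullet> (B *v v) + 2 * (u \<bullet> (X *v v))"
  shows "X \<le>\<^sub>L geom_mean (1/2) A B"
  unfolding loewner_le_def
proof (rule pos_semidef_if_eigenvalues[OF _ A])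
  define G where "G = geom_mean (1/2) A B"
  have G: "pos_def G" "G\<^sup>\<dagger> = G"
    using A B by (simp_all add: G_def conj_transpose_pos_def)
  show "hermitian (G - X)"
    using X G by (simp add: hermitian_diff pos_def_imp_hermitian)
  fix v l
  assume v: "v \<noteq> 0" and eig: "(G - X) *v v = l *\<^sub>R (A *v v)"
  \<comment> \<open>The pair \<open>(- u, v)\<close> lies in the kernel of the block matrix with
    off-diagonal \<open>G\<close>, so testing the block matrix of \<open>X\<close> on it leaves only
    \<open>G - X\<close>.\<close>
  define u where "u = A \<up> (- 1) *v (G *v v)"
  have Au: "A *v u = G *v v"
    using mpow_mult_minus(1)[OF A, of 1] A
    by (simp add: u_def matrix_vector_mul_assoc[of A "A \<up> (- 1)"])
  have "B = G ** A \<up> (- 1) ** G"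
    using geom_half_riccati[OF A B] by (simp add: G_def)
  then have Bv: "B *v v = G *v u"
    by (simp add: u_def matrix_vector_mul_assoc matrix_mul_assoc)
  have "v \<bullet> (G *v u) = u \<bullet> (G *v v)"
    by (simp only: inner_matrix_vector_mult[of v] G(2) inner_commute)
  moreover have "0 \<le> (- u) \<bullet> (A *v (- u)) + v \<bullet> (B *v v) + 2 * ((- u) \<bullet> (X *v v))"
    by (rule block)
  ultimately have "0 \<le> u \<bullet> ((G - X) *v v)"
    by (simp add: Au Bv matrix_vector_mult.minus_right matrix_vector_mult.diff_left inner_diff_right)
  also have "\<dots> = l * (u \<bullet> (A *v v))"
    by (simp add: eig)
  also have "u \<bullet> (A *v v) = v \<bullet> (G *v v)"
    using inner_matrix_vector_mult[of u A v] A Au by (simp add: conj_transpose_pos_def inner_commute)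
  finally show "0 \<le> l"
    using G(1) v unfolding pos_def_iff by (metis mult_neg_pos not_less)
qed

text \<open>The block form of \<open>A\<close>, \<open>B\<close> and their mean is a squared norm.
  Enlarging the diagonal blocks keeps it nonnegative, so the old mean competes in the maximum that
  defines the new one.\<close>

lemma geom_half_mono:
  assumes "pos_def A" "pos_def B" "A \<le>\<^sub>L A'" "B \<le>\<^sub>L B'"
  shows "geom_mean (1/2) A B \<le>\<^sub>L geom_mean (1/2) A' B'"
proof (rule geom_half_max)
  show "pos_def A'" "pos_def B'"
    using assms pos_def_loewner_le by blast+
  show "hermitian (geom_mean (1/2) A B)"
    using assms by (simp add: pos_def_imp_hermitian)
  fix u v
  obtain P R where PR: "A = P ** P\<^sup>\<dagger>" "B = R ** R\<^sup>\<dagger>" "geom_mean (1/2) A B = P ** R\<^sup>\<dagger>"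
    using geom_half_factor assms by metis
  have form: "x \<bullet> ((K ** L\<^sup>\<dagger>) *v y) = (K\<^sup>\<dagger> *v x) \<bullet> (L\<^sup>\<dagger> *v y)" for x y and K L :: "'a cmat"
    by (simp only: matrix_vector_mul_assoc[symmetric] inner_matrix_vector_mult[of x K])
  have "0 \<le> (P\<^sup>\<dagger> *v u + R\<^sup>\<dagger> *v v) \<bullet> (P\<^sup>\<dagger> *v u + R\<^sup>\<dagger> *v v)"
    by simp
  also have "\<dots> = u \<bullet> (A *v u) + v \<bullet> (B *v v) + 2 * (u \<bullet> (geom_mean (1/2) A B *v v))"
    unfolding PR(3) by (subst PR(1), subst PR(2))
      (simp add: form inner_add_left inner_add_right inner_commute)
  also have "\<dots> \<le> u \<bullet> (A' *v u) + v \<bullet> (B' *v v) + 2 * (u \<bullet> (geom_mean (1/2) A B *v v))"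
    using loewner_le_inner[OF assms(3)] loewner_le_inner[OF assms(4)] by (intro add_mono) auto
  finally show "0 \<le> u \<bullet> (A' *v u) + v \<bullet> (B' *v v) + 2 * (u \<bullet> (geom_mean (1/2) A B *v v))" .
qed

text \<open>The Hadamard product of the two Gram block matrices is again a sum of squares, so the
  product of the means competes in the maximum for the Hadamard products.\<close>

lemma geom_half_hadamard:
  assumes "pos_def A" "pos_def B" "pos_def C" "pos_def D"
  shows "geom_mean (1/2) A B \<odot> geom_mean (1/2) C D \<le>\<^sub>L geom_mean (1/2) (A \<odot> C) (B \<odot> D)"
proof (rule geom_half_max)
  show "pos_def (A \<odot> C)" "pos_def (B \<odot> D)"
    using assms by (simp_all add: pos_def_hadamard)
  show "hermitian (geom_mean (1/2) A B \<odot> geom_mean (1/2) C D)"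
    using assms by (simp add: pos_def_imp_hermitian hermitian_hadamard)
  fix u v
  obtain P R where PR: "A = P ** P\<^sup>\<dagger>" "B = R ** R\<^sup>\<dagger>" "geom_mean (1/2) A B = P ** R\<^sup>\<dagger>"
    using geom_half_factor assms by metis
  obtain Q S where QS: "C = Q ** Q\<^sup>\<dagger>" "D = S ** S\<^sup>\<dagger>" "geom_mean (1/2) C D = Q ** S\<^sup>\<dagger>"
    using geom_half_factor assms by metis
  let ?a = "gram_coeff P Q u" and ?b = "gram_coeff R S v"
  have "0 \<le> (\<Sum>k\<in>UNIV. \<Sum>l\<in>UNIV. (?a k l + ?b k l) \<bullet> (?a k l + ?b k l))"
    by (simp add: sum_nonneg)
  also have "\<dots> = u \<bullet> ((A \<odot> C) *v u) + v \<bullet> ((B \<odot> D) *v v)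
      + 2 * (u \<bullet> ((geom_mean (1/2) A B \<odot> geom_mean (1/2) C D) *v v))"
    unfolding PR(3) QS(3) by (subst PR(1), subst PR(2), subst QS(1), subst QS(2))
      (simp add: inner_hadamard_gram inner_add_left inner_add_right inner_commute sum.distrib sum_distrib_left)
  finally show "0 \<le> u \<bullet> ((A \<odot> C) *v u) + v \<bullet> ((B \<odot> D) *v v)
      + 2 * (u \<bullet> ((geom_mean (1/2) A B \<odot> geom_mean (1/2) C D) *v v))" .
qed

text \<open>A missing point would lie in a gap whose endpoints \<open>a\<close> and \<open>b\<close>
  belong to \<open>S\<close>; their midpoint belongs to \<open>S\<close> and falls inside the gap.
  This replaces a passage through dyadic exponents.\<close>

lemma midpoint_closed_unit_interval:
  fixes S :: "real set"
  assumes S: "closed S" "0 \<in> S" "1 \<in> S"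
    and mid: "\<And>s t. s \<in> S \<Longrightarrow> t \<in> S \<Longrightarrow> (s + t) / 2 \<in> S"
    and t: "0 \<le> t" "t \<le> 1"
  shows "t \<in> S"
proof (rule ccontr)
  assume "t \<notin> S"
  define a where "a = Sup (S \<inter> {..t})"
  define b where "b = Inf (S \<inter> {t..})"
  have "a \<in> S \<inter> {..t}"
    unfolding a_def using S t by (intro closed_contains_Sup) auto
  moreover have "b \<in> S \<inter> {t..}"
    unfolding b_def using S t by (intro closed_contains_Inf) auto
  ultimately have ab: "a \<in> S" "b \<in> S" "a < t" "t < b"
    using \<open>t \<notin> S\<close> by (auto simp: order_less_le)
  have upper: "x \<le> a" if "x \<in> S" "x \<le> t" for x
    unfolding a_def using that by (intro cSup_upper) (auto intro: bdd_aboveI)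
  have lower: "b \<le> x" if "x \<in> S" "t \<le> x" for x
    unfolding b_def using that by (intro cInf_lower) (auto intro: bdd_belowI)
  show False
    using upper[OF mid[OF ab(1,2)]] lower[OF mid[OF ab(1,2)]] ab(3,4)
    by (cases "(a + b) / 2 \<le> t") (auto simp: field_simps)
qed

section \<open>Extending the unweighted case to all exponents between 0 and 1\<close>

lemma continuous_on_diag_real:
  assumes "\<And>i. continuous_on S (\<lambda>x. f x i)"
  shows "continuous_on S (\<lambda>x. diag_real (f x))"
proof -
  have "continuous_on S (\<lambda>x. if i = j then complex_of_real (f x i) else 0)" for i j
    using assms by (cases "i = j") (auto intro!: continuous_intros)
  then show ?thesis
    unfolding diag_real_def by (intro continuous_on_vec_lambda)
qed

lemma continuous_on_mpow_exponent:
  assumes "pos_def A" shows "continuous_on S (\<lambda>t. A \<up> t)"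
proof -
  obtain U d where Ud: "\<forall>i. 0 < d i" "\<And>p. A \<up> p = spec U (\<lambda>i. d i powr p)"
    using pos_def_spectral[OF assms] by metis
  show ?thesis
    unfolding Ud(2) spec_def using Ud(1)
    by (intro continuous_intros continuous_on_diag_real) (auto simp: order_less_imp_not_eq2)
qed

lemma continuous_on_geom_mean_exponent [continuous_intros]:
  "pos_def A \<Longrightarrow> pos_def B \<Longrightarrow> continuous_on S (\<lambda>t. geom_mean t A B)"
  unfolding geom_mean_eq by (intro continuous_intros continuous_on_mpow_exponent) auto

theorem geom_mean_mono:
  fixes A B A' B' :: "'m::finite cmat"
  assumes "pos_def A" "pos_def B" "A \<le>\<^sub>L A'" "B \<le>\<^sub>L B'" and t: "0 \<le> t" "t \<le> 1"
  shows "geom_mean t A B \<le>\<^sub>L geom_mean t A' B'"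
proof -
  \<comment> \<open>Phrased with quadratic forms, the set is an intersection of sets given by
    inequalities between continuous functions of \<open>t\<close>, hence closed.\<close>
  define S where "S = {t. \<forall>v. v \<bullet> (geom_mean t A B *v v) \<le> v \<bullet> (geom_mean t A' B' *v v)}"
  have pd: "pos_def A'" "pos_def B'"
    using assms pos_def_loewner_le by blast+
  have S_iff: "s \<in> S \<longleftrightarrow> geom_mean s A B \<le>\<^sub>L geom_mean s A' B'" for s
    using assms pd by (simp add: S_def loewner_le_iff pos_def_imp_hermitian)
  have "t \<in> S"
  proof (rule midpoint_closed_unit_interval[OF _ _ _ _ t])
    show "closed S"
      unfolding S_def using assms pd by (intro closed_Collect_all closed_Collect_le continuous_intros)
    show "0 \<in> S" "1 \<in> S"
      using assms pd by (simp_all add: S_iff)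
    fix s t assume "s \<in> S" "t \<in> S"
    then show "(s + t) / 2 \<in> S"
      using assms pd by (simp add: S_iff geom_mean_midpoint geom_half_mono)
  qed
  then show ?thesis by (simp add: S_iff)
qed

theorem geom_mean_hadamard:
  fixes A B C D :: "'m::finite cmat"
  assumes pd: "pos_def A" "pos_def B" "pos_def C" "pos_def D" and t: "0 \<le> t" "t \<le> 1"
  shows "geom_mean t A B \<odot> geom_mean t C D \<le>\<^sub>L geom_mean t (A \<odot> C) (B \<odot> D)"
proof -
  define S where "S = {t. \<forall>v. v \<bullet> ((geom_mean t A B \<odot> geom_mean t C D) *v v)
    \<le> v \<bullet> (geom_mean t (A \<odot> C) (B \<odot> D) *v v)}"
  note pd' = pos_def_hadamard[OF pd(1,3)] pos_def_hadamard[OF pd(2,4)]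
  have S_iff: "s \<in> S \<longleftrightarrow> geom_mean s A B \<odot> geom_mean s C D \<le>\<^sub>L geom_mean s (A \<odot> C) (B \<odot> D)" for s
    using pd pd' by (simp add: S_def loewner_le_iff hermitian_hadamard pos_def_imp_hermitian)
  have "t \<in> S"
  proof (rule midpoint_closed_unit_interval[OF _ _ _ _ t])
    show "closed S"
      unfolding S_def using pd pd'
      by (intro closed_Collect_all closed_Collect_le continuous_intros hadamard.continuous_on)
    show "0 \<in> S" "1 \<in> S"
      using pd pd' by (simp_all add: S_iff)
    fix s t assume st: "s \<in> S" "t \<in> S"
    \<comment> \<open>The midpoint step needs both facts about exponent \<open>1/2\<close>: first
      the Hadamard inequality for the means at \<open>s\<close> and \<open>t\<close>, then
      monotonicity to insert the inequalities assumed at \<open>s\<close> and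
      \<open>t\<close>.\<close>
    have "geom_mean ((s + t) / 2) A B \<odot> geom_mean ((s + t) / 2) C D
        \<le>\<^sub>L geom_mean (1/2) (geom_mean s A B \<odot> geom_mean s C D) (geom_mean t A B \<odot> geom_mean t C D)"
      using pd by (simp add: geom_mean_midpoint geom_half_hadamard)
    also have "\<dots> \<le>\<^sub>L geom_mean (1/2) (geom_mean s (A \<odot> C) (B \<odot> D)) (geom_mean t (A \<odot> C) (B \<odot> D))"
      using st pd by (simp add: S_iff geom_half_mono pos_def_hadamard)
    also have "\<dots> = geom_mean ((s + t) / 2) (A \<odot> C) (B \<odot> D)"
      using pd' by (simp add: geom_mean_midpoint)
    finally show "(s + t) / 2 \<in> S"
      by (simp add: S_iff)
  qed
  then show ?thesis by (simp add: S_iff)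
qed

section \<open>Continuity of powers and power means\<close>

text \<open>Loewner order intervals serve as the compact convex domains for Brouwer's theorem; for
  \<open>0 < a\<close> they consist of positive definite matrices.\<close>

definition mat_interval :: "real \<Rightarrow> real \<Rightarrow> 'm::finite cmat set"
  where "mat_interval a b = {A. a *\<^sub>R mat 1 \<le>\<^sub>L A \<and> A \<le>\<^sub>L b *\<^sub>R mat 1}"

lemma pos_def_mat_interval: "0 < a \<Longrightarrow> A \<in> mat_interval a b \<Longrightarrow> pos_def A"
  unfolding mat_interval_def using pos_def_loewner_le pos_def_scaleR[OF pos_def_mat_1] by blast

lemma mat_interval_nonempty: "a \<le> b \<Longrightarrow> a *\<^sub>R mat 1 \<in> mat_interval a b"
  using pos_semidef_scaleR[OF pos_def_imp_pos_semidef[OF pos_def_mat_1], of "b - a"]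
  by (simp add: mat_interval_def loewner_le_def scaleR_diff_left pos_semidef_zero)

lemma mat_interval_weighted_sum:
  fixes A :: "'i::finite \<Rightarrow> 'm::finite cmat"
  assumes "w \<in> prob_vectors" "\<And>i. A i \<in> mat_interval a b"
  shows "(\<Sum>i\<in>UNIV. w i *\<^sub>R A i) \<in> mat_interval a b"
proof -
  have w: "0 \<le> w i" "sum w UNIV = 1" for i
    using assms(1) by (auto simp: prob_vectors_def less_imp_le)
  have const: "(\<Sum>i\<in>UNIV. w i *\<^sub>R (r *\<^sub>R mat 1)) = (r *\<^sub>R mat 1 :: 'm cmat)" for r
    by (simp only: scaleR_sum_left[symmetric] w scaleR_one)
  have "(\<Sum>i\<in>UNIV. w i *\<^sub>R (a *\<^sub>R mat 1)) \<le>\<^sub>L (\<Sum>i\<in>UNIV. w i *\<^sub>R A i)"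
    "(\<Sum>i\<in>UNIV. w i *\<^sub>R A i) \<le>\<^sub>L (\<Sum>i\<in>UNIV. w i *\<^sub>R (b *\<^sub>R mat 1))"
    using assms(2) w by (intro loewner_le_sum loewner_le_scaleR; simp add: mat_interval_def)+
  then show ?thesis
    by (simp only: mat_interval_def mem_Collect_eq const)
qed

lemma convex_mat_interval: "convex (mat_interval a b)"
proof (rule convexI)
  fix A B :: "'a cmat" and u v :: real
  assume "A \<in> mat_interval a b" "B \<in> mat_interval a b" and uv: "0 \<le> u" "0 \<le> v" "u + v = 1"
  then have "u *\<^sub>R (a *\<^sub>R mat 1) + v *\<^sub>R (a *\<^sub>R mat 1) \<le>\<^sub>L u *\<^sub>R A + v *\<^sub>R B"
    "u *\<^sub>R A + v *\<^sub>R B \<le>\<^sub>L u *\<^sub>R (b *\<^sub>R mat 1) + v *\<^sub>R (b *\<^sub>R mat 1)"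
    by (intro loewner_le_add loewner_le_scaleR; simp add: mat_interval_def)+
  then show "u *\<^sub>R A + v *\<^sub>R B \<in> mat_interval a b"
    by (simp only: mat_interval_def mem_Collect_eq scaleR_add_left[symmetric] uv scaleR_one)
qed

lemma compact_unitary: "compact {U :: 'm::finite cmat. unitary U}"
proof -
  have "norm U = sqrt (real CARD('m))" if "unitary U" for U :: "'m cmat"
  proof -
    have "(norm (U $ i))\<^sup>2 = 1" for i
    proof -
      have "(U ** U\<^sup>\<dagger>) $ i $ i = 1"
        using that by (simp add: unitary_def mat_def)
      then have "(\<Sum>j\<in>UNIV. complex_of_real ((cmod (U $ i $ j))\<^sup>2)) = 1"
        by (simp add: matrix_matrix_mult_def flip: complex_norm_square)
      then have "complex_of_real (\<Sum>j\<in>UNIV. (cmod (U $ i $ j))\<^sup>2) = 1"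
        by simp
      then have "(\<Sum>j\<in>UNIV. (cmod (U $ i $ j))\<^sup>2) = 1"
        by (simp only: of_real_eq_1_iff)
      then show ?thesis
        by (simp add: norm_vec_def L2_set_def)
    qed
    then show ?thesis
      by (simp add: norm_vec_def[of U] L2_set_def)
  qed
  then have "bounded {U :: 'm cmat. unitary U}"
    by (intro boundedI[of _ "sqrt (real CARD('m))"]) auto
  moreover have "closed {U :: 'm cmat. unitary U}"
    unfolding unitary_def by (intro closed_Collect_conj closed_Collect_eq continuous_intros)
  ultimately show ?thesis
    by (simp add: compact_eq_bounded_closed)
qed

text \<open>Eigenvalues are stored as a vector, so that they range over a compact box and pair with
  the compact set of unitary matrices.\<close>

definition spectral_pairs :: "real \<Rightarrow> real \<Rightarrow> ('m::finite cmat \<times> (real ^ 'm)) set"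
  where "spectral_pairs a b = {U. unitary U} \<times> cbox (\<chi> i. a) (\<chi> i. b)"

lemma compact_spectral_pairs: "compact (spectral_pairs a b)"
  unfolding spectral_pairs_def by (intro compact_Times compact_unitary compact_cbox)

lemma spectral_pairs_iff: "(U, d) \<in> spectral_pairs a b \<longleftrightarrow> unitary U \<and> (\<forall>i. a \<le> d $ i \<and> d $ i \<le> b)"
  by (simp add: spectral_pairs_def mem_box_cart)

lemma mat_interval_eq_image:
  "mat_interval a b = (\<lambda>(U, d). spec U (($) d)) ` spectral_pairs a b"
proof (intro equalityI subsetI)
  fix A :: "'a cmat" assume A: "A \<in> mat_interval a b"
  have "hermitian (A - a *\<^sub>R mat 1)"
    using A by (simp add: mat_interval_def loewner_le_def pos_semidef_def)
  from hermitian_add[OF this hermitian_scaleR[OF hermitian_mat_1]] have "hermitian A"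
    by (metis diff_add_cancel)
  then obtain U d where Ud: "unitary U" "A = spec U d"
    by (rule spectral_decomposition)
  with A have "(U, \<chi> i. d i) \<in> spectral_pairs a b"
    by (simp add: spectral_pairs_iff mat_interval_def mat_loewner_le_spec_iff)
  moreover have "A = (\<lambda>(U, d). spec U (($) d)) (U, \<chi> i. d i)"
    using Ud by (simp add: vec_lambda_inverse)
  ultimately show "A \<in> (\<lambda>(U, d). spec U (($) d)) ` spectral_pairs a b"
    by (rule rev_image_eqI)
qed (auto simp: spectral_pairs_iff mat_interval_def mat_loewner_le_spec_iff)

lemma continuous_on_spec:
  assumes "continuous_on S f" "\<And>i. continuous_on S (\<lambda>x. g x i)"
  shows "continuous_on S (\<lambda>x. spec (f x) (g x))"
  unfolding spec_def using assms by (intro continuous_intros continuous_on_diag_real)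

lemma compact_mat_interval: "compact (mat_interval a b)"
  unfolding mat_interval_eq_image case_prod_unfold
  by (intro compact_continuous_image compact_spectral_pairs continuous_on_spec continuous_intros)

text \<open>The graph of \<open>A \<mapsto> A\<^sup>p\<close> is the compact image of the spectral data \<open>(U, d)\<close>, hence closed.\<close>

lemma continuous_on_mpow_mat_interval:
  fixes a b p :: real
  assumes "0 < a"
  shows "continuous_on (mat_interval a b :: 'm::finite cmat set) (\<lambda>A. A \<up> p)"
proof -
  let ?S = "mat_interval a b :: 'm cmat set" and ?K = "spectral_pairs a b :: ('m cmat \<times> (real ^ 'm)) set"
  define g where "g = (\<lambda>x :: 'm cmat \<times> (real ^ 'm). spec (fst x) (($) (snd x)))"
  define h where "h = (\<lambda>x :: 'm cmat \<times> (real ^ 'm). spec (fst x) (\<lambda>i. (snd x $ i) powr p))"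
  have pos: "0 < snd x $ i" if "x \<in> ?K" for x i
    using that assms by (cases x) (auto simp: spectral_pairs_iff intro: less_le_trans)
  have S: "?S = g ` ?K"
    by (simp add: mat_interval_eq_image g_def case_prod_unfold)
  have mpow_g: "g x \<up> p = h x" if "x \<in> ?K" for x
    using that pos[OF that] unfolding g_def h_def
    by (intro mpow_spec) (auto simp: spectral_pairs_def)
  have g: "continuous_on ?K g"
    unfolding g_def by (intro continuous_on_spec continuous_intros)
  have h: "continuous_on ?K h"
    unfolding h_def using pos
    by (intro continuous_on_spec continuous_intros) (auto simp: order_less_imp_not_eq2)
  have "(\<lambda>A. (A, A \<up> p)) ` ?S = (\<lambda>x. (g x, h x)) ` ?K"
    unfolding S image_image by (intro image_cong refl) (simp add: mpow_g)
  moreover have "compact ((\<lambda>x. (g x, h x)) ` ?K)"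
    by (intro compact_continuous_image compact_spectral_pairs continuous_on_Pair g h)
  ultimately have "closed ((\<lambda>A. (A, A \<up> p)) ` ?S)"
    by (simp add: compact_imp_closed)
  moreover have "compact (h ` ?K)"
    by (intro compact_continuous_image compact_spectral_pairs h)
  moreover have "(\<lambda>A. A \<up> p) \<in> ?S \<rightarrow> h ` ?K"
    unfolding S by (auto simp: mpow_g)
  ultimately show ?thesis
    by (intro continuous_from_closed_graph)
qed

lemma mat_loewner_leI:
  assumes "hermitian A" "\<And>v. norm v = 1 \<Longrightarrow> r \<le> v \<bullet> (A *v v)"
  shows "r *\<^sub>R mat 1 \<le>\<^sub>L A"
proof (rule loewner_leI)
  fix v :: "complex ^ 'a"
  show "v \<bullet> ((r *\<^sub>R mat 1) *v v) \<le> v \<bullet> (A *v v)"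
  proof (cases "v = 0")
    case False
    then have "r \<le> ((1 / norm v) *\<^sub>R v) \<bullet> (A *v ((1 / norm v) *\<^sub>R v))"
      by (intro assms(2)) simp
    then have "r \<le> (v \<bullet> (A *v v)) / (norm v)\<^sup>2"
      by (simp add: matrix_vector_mult.scaleR_right power2_eq_square)
    with False show ?thesis
      by (simp add: matrix_vector_mult.scaleR_left power2_norm_eq_inner[symmetric] pos_le_divide_eq)
  qed simp
qed (use assms hermitian_scaleR[OF hermitian_mat_1] in auto)

text \<open>The quadratic form attains its extrema on the product of \<open>K\<close> with the unit
  sphere, and the minimum is positive. Continuity of powers on a compact domain is thereby reduced
  to order intervals.\<close>

lemma compact_pos_def_bounds:
  fixes K :: "'m::finite cmat set"
  assumes "compact K" "K \<noteq> {}" "\<And>A. A \<in> K \<Longrightarrow> pos_def A"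
  obtains a b where "0 < a" "a \<le> b" "K \<subseteq> mat_interval a b"
proof -
  let ?T = "K \<times> sphere (0 :: complex ^ 'm) 1"
  let ?f = "\<lambda>x. snd x \<bullet> (fst x *v snd x)"
  have T: "compact ?T"
    using assms(1) by (intro compact_Times) auto
  obtain e :: "complex ^ 'm" where "norm e = 1"
    by (rule vector_choose_size[of 1]) auto
  with assms(2) have ne: "?T \<noteq> {}" by auto
  have cont: "continuous_on ?T ?f"
    by (intro continuous_intros)
  obtain x where x: "x \<in> ?T" "\<forall>y\<in>?T. ?f x \<le> ?f y"
    using continuous_attains_inf[OF T ne cont] by blast
  obtain y where y: "y \<in> ?T" "\<forall>x\<in>?T. ?f x \<le> ?f y"
    using continuous_attains_sup[OF T ne cont] by blast
  have "pos_def (fst x)" "snd x \<noteq> 0"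
    using x(1) assms(3) by auto
  then have "0 < ?f x"
    by (simp add: pos_def_iff)
  moreover have "?f x \<le> ?f y"
    using x y by blast
  moreover have "A \<in> mat_interval (?f x) (?f y)" if "A \<in> K" for A
  proof -
    have herm: "hermitian A" "hermitian (- A)"
      using assms(3)[OF that] hermitian_scaleR[of A "- 1"] by (simp_all add: pos_def_imp_hermitian)
    have A: "?f x \<le> v \<bullet> (A *v v)" "v \<bullet> (A *v v) \<le> ?f y" if "norm v = 1" for v
      using x(2)[rule_format, of "(A, v)"] y(2)[rule_format, of "(A, v)"] that \<open>A \<in> K\<close> by auto
    have "?f x *\<^sub>R mat 1 \<le>\<^sub>L A"
      using herm A(1) by (intro mat_loewner_leI)
    \<comment> \<open>The upper bound is the lower-bound lemma applied to
      \<open>- A\<close>.\<close>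
    moreover have "(- ?f y) *\<^sub>R mat 1 \<le>\<^sub>L - A"
      using herm A(2) by (intro mat_loewner_leI) (auto simp: matrix_vector_mult.minus_left)
    then have "A \<le>\<^sub>L ?f y *\<^sub>R mat 1"
      by (simp add: loewner_le_def)
    ultimately show ?thesis by (simp add: mat_interval_def)
  qed
  ultimately show thesis
    by (intro that[of "?f x" "?f y"]) auto
qed

lemma continuous_on_mpow:
  fixes f :: "'a::topological_space \<Rightarrow> 'm::finite cmat"
  assumes "compact S" "continuous_on S f" "\<And>x. x \<in> S \<Longrightarrow> pos_def (f x)"
  shows "continuous_on S (\<lambda>x. f x \<up> p)"
proof (cases "S = {}")
  case False
  obtain a b where ab: "0 < a" "f ` S \<subseteq> mat_interval a b"
    by (rule compact_pos_def_bounds[of "f ` S"]) (use assms False compact_continuous_image[OF assms(2,1)] in auto)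
  show ?thesis
    by (rule continuous_on_compose2[OF continuous_on_mpow_mat_interval[OF ab(1)] assms(2) ab(2)])
qed simp

section \<open>Fixed-point equations: power means and the stationary equation\<close>

lemma pos_def_common_bounds:
  fixes C :: "'i::finite \<Rightarrow> 'm::finite cmat"
  assumes "\<And>k. pos_def (C k)"
  obtains a b where "0 < a" "a \<le> b" "\<And>k. C k \<in> mat_interval a b"
proof (rule compact_pos_def_bounds[of "range C"])
  fix a b assume "0 < a" "a \<le> b" "range C \<subseteq> mat_interval a b"
  then show thesis by (intro that[of a b]) auto
qed (use assms finite_imp_compact[of "range C"] in auto)

text \<open>Choose an order interval containing every \<open>C k\<close>. By monotonicity a mean of
  two of its elements is bounded by the means of its endpoints with themselves, so the interval is
  mapped into itself and Brouwer's theorem applies.\<close>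

lemma exists_power_mean:
  fixes C :: "'i::finite \<Rightarrow> 'm::finite cmat"
  assumes w: "w \<in> prob_vectors" and C: "\<And>k. pos_def (C k)" and t: "0 \<le> t" "t \<le> 1"
  obtains X where "pos_def X" "X = (\<Sum>k\<in>UNIV. w k *\<^sub>R geom_mean t X (C k))"
proof -
  obtain a b where ab: "0 < a" "a \<le> b" "\<And>k. C k \<in> mat_interval a b"
    by (rule pos_def_common_bounds[of C, OF C]) (rule that)
  let ?S = "mat_interval a b :: 'm cmat set"
  let ?F = "\<lambda>X. \<Sum>k\<in>UNIV. w k *\<^sub>R geom_mean t X (C k)"
  have pd: "pos_def X" if "X \<in> ?S" for X
    using pos_def_mat_interval ab(1) that by blast
  have pdI: "pos_def (r *\<^sub>R mat 1 :: 'm cmat)" if "0 < r" for r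
    using that by (simp add: pos_def_scaleR)
  have "geom_mean t X (C k) \<in> ?S" if X: "X \<in> ?S" for X k
  proof -
    have "geom_mean t (a *\<^sub>R mat 1) (a *\<^sub>R mat 1) \<le>\<^sub>L geom_mean t X (C k)"
      using X ab pdI t by (intro geom_mean_mono) (auto simp: mat_interval_def)
    moreover have "geom_mean t X (C k) \<le>\<^sub>L geom_mean t (b *\<^sub>R mat 1) (b *\<^sub>R mat 1)"
      using X ab pd C t by (intro geom_mean_mono) (auto simp: mat_interval_def)
    ultimately show ?thesis
      using ab pdI by (simp add: mat_interval_def)
  qed
  then have maps: "?F \<in> ?S \<rightarrow> ?S"
    by (intro Pi_I mat_interval_weighted_sum[OF w])
  have cont: "continuous_on ?S ?F"
    unfolding geom_mean_eq using pd C
    by (intro continuous_intros continuous_on_mpow compact_mat_interval) auto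
  have "?S \<noteq> {}"
    using mat_interval_nonempty[OF ab(2)] by blast
  then obtain X where "X \<in> ?S" "?F X = X"
    by (rule brouwer[OF compact_mat_interval convex_mat_interval _ cont maps])
  then show thesis
    using that[OF pd[of X]] by simp
qed

text \<open>From \<open>W \<le> r P\<close> monotonicity and homogeneity give \<open>W \<le> r\<^bsup>1-t\<^esup> P\<close>; iterating drives \<open>r\<close> to 1.\<close>

lemma power_mean_comparison:
  fixes C :: "'i::finite \<Rightarrow> 'm::finite cmat"
  assumes w: "\<And>k. 0 \<le> w k" and C: "\<And>k. pos_def (C k)" and t: "0 < t" "t \<le> 1"
    and W: "pos_def W" "W \<le>\<^sub>L (\<Sum>k\<in>UNIV. w k *\<^sub>R geom_mean t W (C k))"
    and P: "pos_def P" "(\<Sum>k\<in>UNIV. w k *\<^sub>R geom_mean t P (C k)) \<le>\<^sub>L P"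
  shows "W \<le>\<^sub>L P"
proof -
  let ?F = "\<lambda>X. \<Sum>k\<in>UNIV. w k *\<^sub>R geom_mean t X (C k)"
  have step: "W \<le>\<^sub>L (r powr (1 - t)) *\<^sub>R P" if r: "0 < r" and le: "W \<le>\<^sub>L r *\<^sub>R P" for r
  proof -
    note W(2)
    also have "?F W \<le>\<^sub>L ?F (r *\<^sub>R P)"
      using W C t w le by (intro loewner_le_sum loewner_le_scaleR geom_mean_mono) auto
    also have "?F (r *\<^sub>R P) = (r powr (1 - t)) *\<^sub>R ?F P"
      using P C r by (simp add: geom_mean_scaleR_left scaleR_sum_right mult.commute)
    also have "\<dots> \<le>\<^sub>L (r powr (1 - t)) *\<^sub>R P"
      using P by (intro loewner_le_scaleR) auto
    finally show ?thesis .
  qed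
  obtain a' b where b: "0 < a'" "a' *\<^sub>R mat 1 \<le>\<^sub>L W" "W \<le>\<^sub>L b *\<^sub>R mat 1"
    by (rule pos_def_bounds[OF W(1)])
  obtain a b' where a: "0 < a" "a *\<^sub>R mat 1 \<le>\<^sub>L P" "P \<le>\<^sub>L b' *\<^sub>R mat 1"
    by (rule pos_def_bounds[OF P(1)])
  \<comment> \<open>Chosen so that \<open>r * a\<close> is at least \<open>b\<close>; the maximum
    with \<open>a\<close> makes \<open>r\<close> positive, as nothing is recorded about the sign of
    \<open>b\<close>.\<close>
  define r where "r = max a b / a"
  have r: "0 < r" using a by (simp add: r_def)
  have "b *\<^sub>R mat 1 \<le>\<^sub>L (max a b *\<^sub>R mat 1 :: 'm cmat)"
    using mat_interval_nonempty[of b "max a b"] by (simp add: mat_interval_def)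
  also have "max a b *\<^sub>R mat 1 = r *\<^sub>R (a *\<^sub>R mat 1 :: 'm cmat)"
    using a by (simp add: r_def)
  also have "\<dots> \<le>\<^sub>L r *\<^sub>R P"
    using a r by (intro loewner_le_scaleR) auto
  finally have "W \<le>\<^sub>L r *\<^sub>R P"
    by (rule loewner_le_trans[OF b(3)])
  then have iter: "W \<le>\<^sub>L (r powr ((1 - t) ^ k)) *\<^sub>R P" for k
  proof (induction k)
    case (Suc k)
    from step[OF _ Suc.IH[OF Suc.prems]] r show ?case
      by (simp add: powr_powr mult.commute)
  qed (use r in simp)
  have lim0: "(\<lambda>k. (1 - t) ^ k) \<longlonglongrightarrow> 0"
    using t by (intro LIMSEQ_power_zero) auto
  have "(\<lambda>k. r powr ((1 - t) ^ k)) \<longlonglongrightarrow> r powr 0"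
    using r by (intro tendsto_powr[OF tendsto_const lim0]) auto
  then have lim: "(\<lambda>k. r powr ((1 - t) ^ k)) \<longlonglongrightarrow> 1"
    using r by simp
  show ?thesis
  proof (rule loewner_leI)
    fix v
    have "(\<lambda>k. r powr ((1 - t) ^ k) * (v \<bullet> (P *v v))) \<longlonglongrightarrow> 1 * (v \<bullet> (P *v v))"
      by (intro tendsto_intros lim)
    moreover have "v \<bullet> (W *v v) \<le> r powr ((1 - t) ^ k) * (v \<bullet> (P *v v))" for k
      using loewner_le_inner[OF iter, of v k] by (simp add: matrix_vector_mult.scaleR_left)
    ultimately show "v \<bullet> (W *v v) \<le> v \<bullet> (P *v v)"
      by (intro LIMSEQ_le_const[of _ "v \<bullet> (P *v v)"]) auto
  qed (use W P in \<open>auto simp: pos_def_imp_hermitian\<close>)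
qed

text \<open>A fixed point is at once a subsolution and a supersolution, so comparing two of them in
  both directions gives the uniqueness that the definite description in \<open>power_mean\<close>
  needs.\<close>

lemma power_mean_props:
  fixes C :: "'i::finite \<Rightarrow> 'm::finite cmat"
  assumes w: "w \<in> prob_vectors" and C: "\<And>k. pos_def (C k)" and t: "0 < t" "t \<le> 1"
  shows "pos_def (power_mean t w C)"
    "(\<Sum>k\<in>UNIV. w k *\<^sub>R geom_mean t (power_mean t w C) (C k)) = power_mean t w C"
proof -
  let ?F = "\<lambda>X. \<Sum>k\<in>UNIV. w k *\<^sub>R geom_mean t X (C k)"
  have w0: "0 \<le> w k" for k
    using w by (simp add: prob_vectors_def less_imp_le)
  have le: "X \<le>\<^sub>L Y" if "pos_def X" "?F X = X" "pos_def Y" "?F Y = Y" for X Y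
  proof (rule power_mean_comparison[OF w0 C t that(1) _ that(3)])
    show "X \<le>\<^sub>L ?F X" "?F Y \<le>\<^sub>L Y"
      by (simp_all only: that(2,4) loewner_le_refl)
  qed
  obtain X where X: "pos_def X" "X = ?F X"
    by (rule exists_power_mean[OF w C less_imp_le[OF t(1)] t(2)])
  have "\<exists>!X. pos_def X \<and> X = ?F X"
  proof (rule ex1I)
    show "pos_def X \<and> X = ?F X"
      using X by (rule conjI)
  next
    fix Y assume Y: "pos_def Y \<and> Y = ?F Y"
    note Y' = Y[THEN conjunct1] Y[THEN conjunct2, symmetric] and X' = X(1) X(2)[symmetric]
    show "Y = X"
      by (rule loewner_le_antisym[OF le[OF Y' X'] le[OF X' Y']])
  qed
  from theI'[OF this] have P: "pos_def (power_mean t w C) \<and> power_mean t w C = ?F (power_mean t w C)"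
    by (fold power_mean_def)
  show "pos_def (power_mean t w C)" "?F (power_mean t w C) = power_mean t w C"
    by (rule P[THEN conjunct1], rule P[THEN conjunct2, symmetric])
qed

text \<open>The scalar version of the stationary equation is
  \<open>y = (c * y) powr \<alpha>\<close>; the exponent \<beta> of its solution satisfies
  \<open>(1 + \<beta>) * \<alpha> = \<beta>\<close>.\<close>

lemma powr_fixed_point:
  fixes c \<alpha> :: real
  assumes "0 < c" "\<alpha> < 1"
  shows "(c * c powr (\<alpha> / (1 - \<alpha>))) powr \<alpha> = c powr (\<alpha> / (1 - \<alpha>))"
proof -
  define \<beta> where "\<beta> = \<alpha> / (1 - \<alpha>)"
  have "\<beta> * (1 - \<alpha>) = \<alpha>"
    using assms by (simp add: \<beta>_def)
  then have "(1 + \<beta>) * \<alpha> = \<beta>"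
    by (simp add: algebra_simps)
  moreover have "c * c powr \<beta> = c powr (1 + \<beta>)"
    using assms by (simp add: powr_add)
  ultimately have "(c * c powr \<beta>) powr \<alpha> = c powr \<beta>"
    by (simp only: powr_powr)
  then show ?thesis
    by (simp only: \<beta>_def)
qed

text \<open>Taking the power \<alpha> / z of the right-hand side gives a self-map. With
  \<open>C k\<close> between \<open>a\<close> and \<open>b\<close> times the identity, its values
  are bounded by those of the scalar maps \<open>(a * y) powr \<alpha>\<close> and
  \<open>(b * y) powr \<alpha>\<close>, so the scalar fixed points \<open>lo\<close> and
  \<open>hi\<close> span an invariant order interval.\<close>

lemma exists_stationary:
  fixes C :: "'i::finite \<Rightarrow> 'm::finite cmat"
  assumes w: "w \<in> prob_vectors" and C: "\<And>k. pos_def (C k)"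
    and \<alpha>: "0 < \<alpha>" "\<alpha> < 1" and z: "0 < z"
  obtains Y where "pos_def Y"
    "Y \<up> (z / \<alpha>) = (\<Sum>k\<in>UNIV. w k *\<^sub>R (Y \<up> (1/2) ** C k ** Y \<up> (1/2)) \<up> z)"
proof -
  obtain a b where ab: "0 < a" "a \<le> b" "\<And>k. C k \<in> mat_interval a b"
    by (rule pos_def_common_bounds[of C, OF C]) (rule that)
  define lo where "lo = a powr (\<alpha> / (1 - \<alpha>))"
  define hi where "hi = b powr (\<alpha> / (1 - \<alpha>))"
  have lohi: "0 < lo" "lo \<le> hi" "(a * lo) powr \<alpha> = lo" "(b * hi) powr \<alpha> = hi"
    using ab \<alpha> by (auto simp: lo_def hi_def powr_fixed_point intro!: powr_mono2)
  let ?S = "mat_interval lo hi :: 'm cmat set"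
  let ?G = "\<lambda>Y. \<Sum>k\<in>UNIV. w k *\<^sub>R (Y \<up> (1/2) ** C k ** Y \<up> (1/2)) \<up> z"
  let ?F = "\<lambda>Y. ?G Y \<up> (\<alpha> / z)"
  have pd: "pos_def Y" if "Y \<in> ?S" for Y
    using pos_def_mat_interval lohi(1) that by blast
  have w0: "0 < w k" for k
    using w by (simp add: prob_vectors_def)
  have pdG: "pos_def (?G Y)" if "Y \<in> ?S" for Y
    using pd[OF that] C w0 by (intro pos_def_weighted_sum) auto
  have "(Y \<up> (1/2) ** C k ** Y \<up> (1/2)) \<up> z \<in> mat_interval ((a * lo) powr z) ((b * hi) powr z)"
    if Y: "Y \<in> ?S" for Y k
  proof -
    let ?Y = "Y \<up> (1/2)"
    note pdY = pd[OF Y]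
    have conj: "?Y\<^sup>\<dagger> ** (r *\<^sub>R mat 1) ** ?Y = r *\<^sub>R Y" for r
      using pdY by (simp add: matrix_mult.scaleR_left matrix_mult.scaleR_right mpow_half_sq)
    have "(a * lo) *\<^sub>R mat 1 \<le>\<^sub>L a *\<^sub>R Y"
      using loewner_le_scaleR[of "lo *\<^sub>R mat 1" Y a] Y ab(1) by (simp add: mat_interval_def)
    also have "\<dots> \<le>\<^sub>L ?Y ** C k ** ?Y"
      using loewner_le_congruence[of "a *\<^sub>R mat 1" "C k" ?Y] ab(3)[of k] pdY
      unfolding conj by (simp add: mat_interval_def)
    finally have lower: "(a * lo) *\<^sub>R mat 1 \<le>\<^sub>L ?Y ** C k ** ?Y" .
    have "?Y ** C k ** ?Y \<le>\<^sub>L b *\<^sub>R Y"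
      using loewner_le_congruence[of "C k" "b *\<^sub>R mat 1" ?Y] ab(3)[of k] pdY
      unfolding conj by (simp add: mat_interval_def)
    also have "\<dots> \<le>\<^sub>L (b * hi) *\<^sub>R mat 1"
      using loewner_le_scaleR[of Y "hi *\<^sub>R mat 1" b] Y ab(1,2) by (simp add: mat_interval_def)
    finally have "?Y ** C k ** ?Y \<le>\<^sub>L (b * hi) *\<^sub>R mat 1" .
    with lower show ?thesis
      using pdY C ab lohi z
      by (simp add: mat_interval_def mat_loewner_le_mpow mpow_loewner_le_mat)
  qed
  then have G: "?G Y \<in> mat_interval ((a * lo) powr z) ((b * hi) powr z)" if "Y \<in> ?S" for Y
    using that by (intro mat_interval_weighted_sum[OF w])
  have "?F Y \<in> mat_interval (((a * lo) powr z) powr (\<alpha> / z)) (((b * hi) powr z) powr (\<alpha> / z))" if "Y \<in> ?S" for Y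
    using G[OF that] pdG[OF that] \<alpha> z
    by (simp only: mat_interval_def mem_Collect_eq) (simp add: mat_loewner_le_mpow mpow_loewner_le_mat)
  then have maps: "?F \<in> ?S \<rightarrow> ?S"
    using z lohi by (intro Pi_I) (simp add: powr_powr)
  have cont: "continuous_on ?S ?F"
    using pdG pd C
    by (intro continuous_intros continuous_on_mpow compact_mat_interval) auto
  have "?S \<noteq> {}"
    using mat_interval_nonempty[OF lohi(2)] by blast
  then obtain Y where Y: "Y \<in> ?S" "?F Y = Y"
    by (rule brouwer[OF compact_mat_interval convex_mat_interval _ cont maps])
  have "Y \<up> (z / \<alpha>) = ?F Y \<up> (z / \<alpha>)"
    by (simp only: Y(2))
  also have "\<dots> = ?G Y"
    using pdG[OF Y(1)] \<alpha> z by (simp add: mpow_mpow)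
  finally show thesis
    by (rule that[OF pd[OF Y(1)]])
qed

section \<open>Trace inequalities and the right mean\<close>

text \<open>Young's inequality alone is not strict. Applying it to the square root \<open>s\<close>
  of \<open>r\<close> and squaring leaves the explicit positive gap
  \<open>z * (1 - z) * (s - 1)\<^sup>2\<close>.\<close>

lemma bernoulli_powr_less:
  fixes r z :: real
  assumes "0 < r" "r \<noteq> 1" "0 < z" "z < 1"
  shows "r powr z < 1 + z * (r - 1)"
proof -
  define s where "s = sqrt r"
  have s: "0 < s" "s \<noteq> 1" "r = s\<^sup>2"
    using assms by (auto simp: s_def)
  have "s powr z * 1 powr (1 - z) \<le> z * s + (1 - z) * 1"
    using assms s by (intro Youngs_inequality_0) auto
  then have "(s powr z)\<^sup>2 \<le> (z * s + (1 - z))\<^sup>2"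
    by (intro power_mono) auto
  moreover have "r powr z = (s powr z)\<^sup>2"
    using s by (simp add: power2_eq_square powr_mult)
  moreover have "1 + z * (r - 1) - (z * s + (1 - z))\<^sup>2 = z * (1 - z) * (s - 1)\<^sup>2"
    unfolding s(3) by algebra
  moreover have "0 < z * (1 - z) * (s - 1)\<^sup>2"
    using assms s by simp
  ultimately show ?thesis by linarith
qed

lemma powr_tangent_less:
  fixes x y z :: real
  assumes "0 < x" "0 < y" "x \<noteq> y" "0 < z" "z < 1"
  shows "x powr z < y powr z + z * y powr (z - 1) * (x - y)"
proof -
  have "(x / y) powr z < 1 + z * (x / y - 1)"
    using assms by (intro bernoulli_powr_less) auto
  then have "y powr z * (x / y) powr z < y powr z * (1 + z * (x / y - 1))"
    using assms by simp
  moreover have "y powr z * (x / y) powr z = x powr z"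
    using assms by (simp add: powr_divide)
  moreover have "y powr z = y powr (z - 1) * y"
    using assms by (simp add: powr_diff)
  then have "y powr z * (1 + z * (x / y - 1)) = y powr z + z * y powr (z - 1) * (x - y)"
    using assms by (simp add: field_simps)
  ultimately show ?thesis by simp
qed

text \<open>Convexity for \<open>q\<close> at least 1 is concavity of the inverse power: Young's
  inequality with weight \<open>1 / q\<close> is applied to \<open>(x / y) powr q\<close> and
  rescaled.\<close>

lemma powr_tangent_ge:
  fixes x y q :: real
  assumes "0 < x" "0 < y" "1 \<le> q"
  shows "y powr q + q * y powr (q - 1) * (x - y) \<le> x powr q"
proof -
  define s where "s = (x / y) powr q"
  have "s powr (1 / q) * 1 powr (1 - 1 / q) \<le> 1 / q * s + (1 - 1 / q) * 1"
    using assms by (intro Youngs_inequality_0) (auto simp: s_def)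
  moreover have "s powr (1 / q) = x / y"
    using assms by (simp add: s_def powr_powr)
  ultimately have "q * (x / y) \<le> q * (1 / q * s + (1 - 1 / q))"
    using assms by (intro mult_left_mono) auto
  also have "\<dots> = s + q - 1"
    using assms by (simp add: field_simps)
  finally have "1 + q * (x / y - 1) \<le> s"
    by (simp add: algebra_simps)
  then have "y powr q * (1 + q * (x / y - 1)) \<le> y powr q * s"
    using assms by (intro mult_left_mono) auto
  moreover have "y powr q * s = x powr q"
    using assms by (simp add: s_def powr_divide)
  moreover have "y powr q = y powr (q - 1) * y"
    using assms by (simp add: powr_diff)
  then have "y powr q * (1 + q * (x / y - 1)) = y powr q + q * y powr (q - 1) * (x - y)"
    using assms by (simp add: field_simps)
  ultimately show ?thesis by simp
qed

text \<open>Cyclicity of the trace leaves only the overlap matrix of the two eigenbases. Its squared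
  moduli are nonnegative weights, which turn trace inequalities into weighted scalar ones.\<close>

lemma Re_trace_spec_mult:
  fixes U V :: "'m::finite cmat"
  shows "Re (trace (spec V e ** spec U d)) =
    (\<Sum>i\<in>UNIV. \<Sum>j\<in>UNIV. (cmod ((V\<^sup>\<dagger> ** U) $ i $ j))\<^sup>2 * (e i * d j))"
proof -
  define W where "W = V\<^sup>\<dagger> ** U"
  have "spec V e ** spec U d = V ** (diag_real e ** (V\<^sup>\<dagger> ** U) ** diag_real d ** U\<^sup>\<dagger>)"
    by (simp only: spec_def matrix_mul_assoc)
  then have "trace (spec V e ** spec U d) = trace ((diag_real e ** W ** diag_real d ** U\<^sup>\<dagger>) ** V)"
    by (simp only: W_def trace_mul_sym[of V])
  also have "(diag_real e ** W ** diag_real d ** U\<^sup>\<dagger>) ** V = (diag_real e ** W ** diag_real d) ** W\<^sup>\<dagger>"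
    by (simp add: W_def conj_transpose_mult matrix_mul_assoc)
  also have "trace \<dots> = (\<Sum>i\<in>UNIV. \<Sum>j\<in>UNIV. (e i * W $ i $ j * d j) * cnj (W $ i $ j))"
    by (simp add: trace_def matrix_matrix_mult_def[of _ "W\<^sup>\<dagger>"] diag_real_mult_nth diag_real_mult_left_nth)
  also have "\<dots> = (\<Sum>i\<in>UNIV. \<Sum>j\<in>UNIV. complex_of_real ((cmod (W $ i $ j))\<^sup>2 * (e i * d j)))"
    by (intro sum.cong refl) (simp only: of_real_mult complex_norm_square mult_ac)
  finally show ?thesis
    by (simp add: W_def)
qed

text \<open>Klein's inequality as an identity: with \<open>g\<close> in the role of the derivative
  of \<open>f\<close>, the gap between the tangent at \<open>spec V e\<close> and the value at
  \<open>spec U d\<close> is a weighted sum of scalar tangent gaps, and the sign of these decides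
  the inequality.\<close>

lemma trace_spec_tangent:
  fixes U V :: "'m::finite cmat"
  assumes U: "unitary U" and V: "unitary V"
  shows "Re (trace (spec V (\<lambda>i. f (e i)))) + Re (trace (spec V (\<lambda>i. g (e i)) ** (spec U d - spec V e)))
      - Re (trace (spec U (\<lambda>j. f (d j))))
    = (\<Sum>i\<in>UNIV. \<Sum>j\<in>UNIV. (cmod ((V\<^sup>\<dagger> ** U) $ i $ j))\<^sup>2 * (f (e i) + g (e i) * (d j - e i) - f (d j)))"
proof -
  let ?c = "\<lambda>i j. (cmod ((V\<^sup>\<dagger> ** U) $ i $ j))\<^sup>2"
  have trV: "Re (trace (spec V h)) = (\<Sum>i\<in>UNIV. \<Sum>j\<in>UNIV. ?c i j * h i)" for h
    using Re_trace_spec_mult[of V h U "\<lambda>_. 1"] spec_one[OF U] by simp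
  have trU: "Re (trace (spec U h)) = (\<Sum>i\<in>UNIV. \<Sum>j\<in>UNIV. ?c i j * h j)" for h
    using Re_trace_spec_mult[of V "\<lambda>_. 1" U h] spec_one[OF V] by simp
  show ?thesis
    by (simp add: matrix_mult.diff_right trace_diff spec_mult[OF V] Re_trace_spec_mult trV trU
        sum.distrib sum_subtractf algebra_simps)
qed

lemma trace_mpow_less:
  fixes M N :: "'m::finite cmat"
  assumes M: "pos_def M" and N: "pos_def N" and z: "0 < z" "z < 1" and ne: "M \<noteq> N"
  shows "Re (trace (M \<up> z)) < Re (trace (N \<up> z)) + z * Re (trace (N \<up> (z - 1) ** (M - N)))"
proof -
  obtain U d where U: "unitary U" "\<forall>i. 0 < d i" "M = spec U d" "\<And>p. M \<up> p = spec U (\<lambda>i. d i powr p)"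
    by (rule pos_def_spectral[OF M]) (rule that)
  obtain V e where V: "unitary V" "\<forall>i. 0 < e i" "N = spec V e" "\<And>p. N \<up> p = spec V (\<lambda>i. e i powr p)"
    by (rule pos_def_spectral[OF N]) (rule that)
  let ?c = "\<lambda>i j. (cmod ((V\<^sup>\<dagger> ** U) $ i $ j))\<^sup>2"
  let ?h = "\<lambda>i j. e i powr z + z * e i powr (z - 1) * (d j - e i) - d j powr z"
  have pos: "0 < ?h i j" if "d j \<noteq> e i" for i j
    using powr_tangent_less[of "d j" "e i" z] U V z that by simp
  then have nonneg: "0 \<le> ?c i j * ?h i j" for i j
  proof (cases "d j = e i")
    case False
    then show ?thesis
      using pos by (intro mult_nonneg_nonneg zero_le_power2 less_imp_le)
  qed simp
  \<comment> \<open>Strictness: distinct matrices must have two different eigenvalues whose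
    eigenvectors overlap, which gives one positive term.\<close>
  obtain i j where ij: "(V\<^sup>\<dagger> ** U) $ i $ j \<noteq> 0" "d j \<noteq> e i"
    using ne spec_eq_iff[OF U(1) V(1)] unfolding U(3) V(3) by metis
  have "0 < ?c i j * ?h i j"
    using ij(1) pos[OF ij(2)] by (intro mult_pos_pos zero_less_power) simp_all
  then have inner: "0 < (\<Sum>j\<in>UNIV. ?c i j * ?h i j)"
    using nonneg by (intro sum_pos2[of UNIV j]) auto
  have "0 < (\<Sum>i\<in>UNIV. \<Sum>j\<in>UNIV. ?c i j * ?h i j)"
    by (rule sum_pos2[where i = i]) (use inner nonneg in \<open>auto intro: sum_nonneg\<close>)
  also have "\<dots> = Re (trace (N \<up> z)) + Re (trace (z *\<^sub>R N \<up> (z - 1) ** (M - N))) - Re (trace (M \<up> z))"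
    unfolding U(4) V(4) spec_scaleR unfolding U(3) V(3)
    by (rule trace_spec_tangent[OF U(1) V(1), symmetric])
  finally show ?thesis
    by (simp add: matrix_mult.scaleR_left trace_scaleR)
qed

lemma trace_mpow_ge:
  fixes M N :: "'m::finite cmat"
  assumes M: "pos_def M" and N: "pos_def N" and q: "1 \<le> q"
  shows "Re (trace (N \<up> q)) + q * Re (trace (N \<up> (q - 1) ** (M - N))) \<le> Re (trace (M \<up> q))"
proof -
  obtain U d where U: "unitary U" "\<forall>i. 0 < d i" "M = spec U d" "\<And>p. M \<up> p = spec U (\<lambda>i. d i powr p)"
    by (rule pos_def_spectral[OF M]) (rule that)
  obtain V e where V: "unitary V" "\<forall>i. 0 < e i" "N = spec V e" "\<And>p. N \<up> p = spec V (\<lambda>i. e i powr p)"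
    by (rule pos_def_spectral[OF N]) (rule that)
  let ?c = "\<lambda>i j. (cmod ((V\<^sup>\<dagger> ** U) $ i $ j))\<^sup>2"
  let ?h = "\<lambda>i j. e i powr q + q * e i powr (q - 1) * (d j - e i) - d j powr q"
  have "?h i j \<le> 0" for i j
    using powr_tangent_ge[of "d j" "e i" q] U V q by simp
  then have "(\<Sum>i\<in>UNIV. \<Sum>j\<in>UNIV. ?c i j * ?h i j) \<le> 0"
    by (intro sum_nonpos mult_nonneg_nonpos) auto
  also have "(\<Sum>i\<in>UNIV. \<Sum>j\<in>UNIV. ?c i j * ?h i j)
      = Re (trace (N \<up> q)) + Re (trace (q *\<^sub>R N \<up> (q - 1) ** (M - N))) - Re (trace (M \<up> q))"
    unfolding U(4) V(4) spec_scaleR unfolding U(3) V(3)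
    by (rule trace_spec_tangent[OF U(1) V(1), symmetric])
  finally show ?thesis
    by (simp add: matrix_mult.scaleR_left trace_scaleR)
qed

section \<open>Polar decomposition and the gradient of the trace functional\<close>

lemma mpow_unitary_congruence:
  fixes Q H :: "'m::finite cmat"
  assumes Q: "unitary Q" and H: "pos_def H"
  shows "(Q ** H ** Q\<^sup>\<dagger>) \<up> p = Q ** H \<up> p ** Q\<^sup>\<dagger>"
proof -
  obtain U d where U: "unitary U" "\<forall>i. 0 < d i" "H = spec U d" "\<And>p. H \<up> p = spec U (\<lambda>i. d i powr p)"
    by (rule pos_def_spectral[OF H]) (rule that)
  have QU: "unitary (Q ** U)"
  proof (rule unitary_if_left)
    have "(Q ** U)\<^sup>\<dagger> ** (Q ** U) = U\<^sup>\<dagger> ** ((Q\<^sup>\<dagger> ** Q) ** U)"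
      by (simp only: conj_transpose_mult matrix_mul_assoc)
    with Q U(1) show "(Q ** U)\<^sup>\<dagger> ** (Q ** U) = mat 1"
      by (simp add: unitary_def)
  qed
  have spec_QU: "Q ** spec U f ** Q\<^sup>\<dagger> = spec (Q ** U) f" for f
    by (simp add: spec_def conj_transpose_mult matrix_mul_assoc)
  show ?thesis
    unfolding U(4) spec_QU unfolding U(3) spec_QU by (rule mpow_spec[OF QU U(2)])
qed

text \<open>With the polar decomposition \<open>L = Q (L\<^sup>* L)\<^bsup>1/2\<^esup>\<close> one has \<open>L L\<^sup>* = Q (L\<^sup>* L) Q\<^sup>*\<close>.\<close>

lemma mpow_intertwine:
  fixes L L' :: "'m::finite cmat"
  assumes inv: "L' ** L = mat 1"
  shows "L ** (L\<^sup>\<dagger> ** L) \<up> p = (L ** L\<^sup>\<dagger>) \<up> p ** L"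
proof -
  define H where "H = L\<^sup>\<dagger> ** L"
  have H: "pos_def H"
    using pos_def_congruence[OF pos_def_mat_1 inv] by (simp add: H_def)
  define Q where "Q = L ** H \<up> (- (1/2))"
  have "Q\<^sup>\<dagger> ** Q = H \<up> (- (1/2)) ** H ** H \<up> (- (1/2))"
    using H by (simp add: Q_def conj_transpose_mult matrix_mul_assoc[symmetric])
      (simp add: H_def matrix_mul_assoc)
  also have "\<dots> = H \<up> (- (1/2)) ** H \<up> 1 ** H \<up> (- (1/2))"
    using H by simp
  also have "\<dots> = mat 1"
    using H by (simp only: mpow_add) simp
  finally have "unitary Q" by (rule unitary_if_left)
  have L: "L = Q ** H \<up> (1/2)"
    using H mpow_mult_minus(2)[OF H, of "1/2"] by (simp add: Q_def matrix_mul_assoc[symmetric])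
  have "L ** L\<^sup>\<dagger> = Q ** (H \<up> (1/2) ** H \<up> (1/2)) ** Q\<^sup>\<dagger>"
    by (subst (1 2) L) (simp add: H conj_transpose_mult matrix_mul_assoc)
  then have "(L ** L\<^sup>\<dagger>) \<up> p ** L = Q ** H \<up> p ** Q\<^sup>\<dagger> ** L"
    using H \<open>unitary Q\<close> by (simp only: mpow_half_sq mpow_unitary_congruence)
  also have "\<dots> = Q ** H \<up> p ** (Q\<^sup>\<dagger> ** Q) ** H \<up> (1/2)"
    by (subst L) (simp only: matrix_mul_assoc)
  also have "\<dots> = Q ** (H \<up> p ** H \<up> (1/2))"
    using \<open>unitary Q\<close> by (simp add: unitary_def matrix_mul_assoc)
  also have "H \<up> p ** H \<up> (1/2) = H \<up> (1/2) ** H \<up> p"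
    using H by (simp add: mpow_add add.commute)
  also have "Q ** (H \<up> (1/2) ** H \<up> p) = L ** H \<up> p"
    by (subst L) (simp add: matrix_mul_assoc)
  finally show ?thesis by (simp add: H_def)
qed

lemma geom_mean_mpow_minus_1:
  assumes "pos_def Y"
  shows "geom_mean z (Y \<up> (- 1)) C = Y \<up> (- (1/2)) ** (Y \<up> (1/2) ** C ** Y \<up> (1/2)) \<up> z ** Y \<up> (- (1/2))"
  using assms by (simp add: geom_mean_eq mpow_mpow)

text \<open>Up to the factor \<open>z\<close>, the right-hand side is the gradient of
  \<open>Y\<close> \<mapsto> tr \<open>(K ** Y ** K) \<up> z\<close>. Intertwining the two products
  of \<open>L = Y \<up> (1/2) ** K\<close> with its adjoint identifies this gradient as a geometric
  mean.\<close>

lemma geom_mean_mpow_minus_1_square: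
  assumes Y: "pos_def Y" and K: "pos_def K"
  shows "geom_mean z (Y \<up> (- 1)) (K ** K) = K ** (K ** Y ** K) \<up> (z - 1) ** K"
proof -
  define L where "L = Y \<up> (1/2) ** K"
  have L_adj: "L\<^sup>\<dagger> = K ** Y \<up> (1/2)"
    using Y K by (simp add: L_def conj_transpose_mult conj_transpose_pos_def)
  have inv: "(K \<up> (- 1) ** Y \<up> (- (1/2))) ** L = mat 1"
    using Y K mpow_mult_minus(2)[OF K, of 1] by (simp add: L_def matrix_mul_assoc[symmetric])
  have LL: "L\<^sup>\<dagger> ** L = K ** Y ** K" "L ** L\<^sup>\<dagger> = Y \<up> (1/2) ** (K ** K) ** Y \<up> (1/2)"
  proof -
    have "L\<^sup>\<dagger> ** L = K ** (Y \<up> (1/2) ** Y \<up> (1/2)) ** K"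
      unfolding L_adj by (simp only: L_def matrix_mul_assoc)
    then show "L\<^sup>\<dagger> ** L = K ** Y ** K"
      using Y by (simp only: mpow_half_sq)
    show "L ** L\<^sup>\<dagger> = Y \<up> (1/2) ** (K ** K) ** Y \<up> (1/2)"
      unfolding L_adj by (simp only: L_def matrix_mul_assoc)
  qed
  have pd: "pos_def (L ** L\<^sup>\<dagger>)"
    unfolding LL using Y K pos_def_congruence[OF pos_def_mat_1, of "K \<up> (- 1)" K] mpow_mult_minus(2)[OF K, of 1]
    by (simp add: conj_transpose_pos_def)
  have "L ** (L\<^sup>\<dagger> ** L) \<up> (z - 1) ** L\<^sup>\<dagger> = (L ** L\<^sup>\<dagger>) \<up> (z - 1) ** (L ** L\<^sup>\<dagger>) \<up> 1"
    using pd by (simp add: mpow_intertwine[OF inv] matrix_mul_assoc[symmetric])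
  also have "\<dots> = (L ** L\<^sup>\<dagger>) \<up> z"
    using mpow_add[OF pd, of "z - 1" 1] by (simp only: diff_add_cancel)
  finally have "geom_mean z (Y \<up> (- 1)) (K ** K) =
      Y \<up> (- (1/2)) ** (L ** (K ** Y ** K) \<up> (z - 1) ** L\<^sup>\<dagger>) ** Y \<up> (- (1/2))"
    using geom_mean_mpow_minus_1[OF Y] LL by simp
  also have "\<dots> = K ** (K ** Y ** K) \<up> (z - 1) ** K"
    using Y unfolding L_adj by (simp add: L_def matrix_mul_assoc[symmetric])
  finally show ?thesis .
qed

text \<open>The strict tangent inequality for \<open>K ** Y ** K\<close>, with cyclicity of the
  trace moving the outer \<open>K\<close> so that the gradient appears as a geometric mean.
  Invertibility of \<open>K\<close> keeps the two congruent matrices distinct.\<close>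

lemma trace_mpow_congruence_less:
  fixes K Y Z :: "'m::finite cmat"
  assumes K: "pos_def K" and Y: "pos_def Y" and Z: "pos_def Z" and ne: "Z \<noteq> Y" and z: "0 < z" "z < 1"
  shows "Re (trace ((K ** Z ** K) \<up> z)) <
    Re (trace ((K ** Y ** K) \<up> z)) + z * Re (trace (geom_mean z (Y \<up> (- 1)) (K ** K) ** (Z - Y)))"
proof -
  have cancel: "K \<up> (- 1) ** (K ** X ** K) ** K \<up> (- 1) = X" for X
    using mpow_mult_minus[OF K, of 1] K by (simp add: matrix_mul_assoc[symmetric] matrix_mult_cancel)
  have "pos_def (K ** X ** K)" if "pos_def X" for X
    using pos_def_mpow_congruence[OF K that, of 1] K by simp
  moreover have "K ** Z ** K \<noteq> K ** Y ** K"
    using ne cancel by metis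
  ultimately have "Re (trace ((K ** Z ** K) \<up> z)) < Re (trace ((K ** Y ** K) \<up> z))
      + z * Re (trace ((K ** Y ** K) \<up> (z - 1) ** (K ** Z ** K - K ** Y ** K)))"
    using Y Z z by (intro trace_mpow_less) auto
  also have "(K ** Y ** K) \<up> (z - 1) ** (K ** Z ** K - K ** Y ** K)
      = ((K ** Y ** K) \<up> (z - 1) ** K ** (Z - Y)) ** K"
    by (simp add: matrix_mult.diff_left matrix_mult.diff_right matrix_mul_assoc)
  also have "trace \<dots> = trace (K ** ((K ** Y ** K) \<up> (z - 1) ** K ** (Z - Y)))"
    by (rule trace_mul_sym)
  also have "K ** ((K ** Y ** K) \<up> (z - 1) ** K ** (Z - Y))
      = geom_mean z (Y \<up> (- 1)) (K ** K) ** (Z - Y)"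
    by (simp add: geom_mean_mpow_minus_1_square[OF Y K] matrix_mul_assoc)
  finally show ?thesis .
qed

section \<open>The right mean and its stationary equation\<close>

lemma az_divergence_eq:
  "az_divergence \<alpha> z A X = (1 - \<alpha>) * Re (trace A) + \<alpha> * Re (trace X)
    - Re (trace ((A \<up> ((1 - \<alpha>) / (2 * z)) ** X \<up> (\<alpha> / z) ** A \<up> ((1 - \<alpha>) / (2 * z))) \<up> z))"
  by (simp add: az_divergence_def trace_add trace_scaleR)

text \<open>In the variable \<open>Y = X\<^bsup>\<alpha>/z\<^esup>\<close> the objective is strictly convex, and Klein's inequality shows that
  a stationary point is its unique minimiser.\<close>

lemma right_mean_eq:
  fixes A :: "'n::finite \<Rightarrow> 'm::finite cmat"
  assumes A: "\<And>j. pos_def (A j)" and w: "w \<in> prob_vectors"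
    and \<alpha>: "0 < \<alpha>" "\<alpha> \<le> z" and z: "z < 1" and X: "pos_def X"
    and stat: "X \<up> (1 - \<alpha> / z) = (\<Sum>j\<in>UNIV. w j *\<^sub>R geom_mean z (X \<up> (- (\<alpha> / z))) (A j \<up> ((1 - \<alpha>) / z)))"
  shows "right_mean \<alpha> z w A = X"
proof -
  have z0: "0 < z" using \<alpha> by simp
  have w_pos: "0 < w j" for j
    using w by (simp add: prob_vectors_def)
  define K where "K j = A j \<up> ((1 - \<alpha>) / (2 * z))" for j
  \<comment> \<open>In the variable \<open>Y\<close> the linear term \<alpha> tr \<open>X\<close>
    becomes the convex function \<alpha> tr \<open>Y \<up> q\<close>, whose gradient at
    \<open>Y\<close> is \<open>(\<alpha> * q) *\<^sub>R Y \<up> (q - 1)\<close>, that is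
    \<open>z *\<^sub>R S\<close>.\<close>
  define q where "q = z / \<alpha>"
  define Y where "Y = X \<up> (\<alpha> / z)"
  define S where "S = X \<up> (1 - \<alpha> / z)"
  have K: "pos_def (K j)" for j
    using A by (simp add: K_def)
  have KK: "K j ** K j = A j \<up> ((1 - \<alpha>) / z)" for j
  proof -
    have "(1 - \<alpha>) / (2 * z) + (1 - \<alpha>) / (2 * z) = (1 - \<alpha>) / z"
      using z0 by (simp add: field_simps)
    then show ?thesis
      by (simp only: K_def mpow_add[OF A])
  qed
  have q: "1 \<le> q" "\<alpha> * q = z"
    using \<alpha> by (simp_all add: q_def)
  have Y: "pos_def Y" "Y \<up> q = X" "Y \<up> (q - 1) = S" "Y \<up> (- 1) = X \<up> (- (\<alpha> / z))"
  proof -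
    have "\<alpha> / z * q = 1" "\<alpha> / z * (q - 1) = 1 - \<alpha> / z" "\<alpha> / z * (- 1) = - (\<alpha> / z)"
      using \<alpha> z0 by (simp_all add: q_def field_simps)
    then show "Y \<up> q = X" "Y \<up> (q - 1) = S" "Y \<up> (- 1) = X \<up> (- (\<alpha> / z))"
      by (simp_all only: Y_def S_def mpow_mpow[OF X] mpow_1[OF X])
    show "pos_def Y"
      using X by (simp add: Y_def)
  qed
  have S: "S = (\<Sum>j\<in>UNIV. w j *\<^sub>R geom_mean z (Y \<up> (- 1)) (K j ** K j))"
    using stat by (simp add: S_def Y(4) KK)
  let ?f = "\<lambda>X. \<Sum>j\<in>UNIV. w j * az_divergence \<alpha> z (A j) X"
  have f: "?f X' = (\<Sum>j\<in>UNIV. w j * ((1 - \<alpha>) * Re (trace (A j)))) + \<alpha> * Re (trace X')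
      - (\<Sum>j\<in>UNIV. w j * Re (trace ((K j ** X' \<up> (\<alpha> / z) ** K j) \<up> z)))" if "pos_def X'" for X'
  proof -
    have "(\<Sum>j\<in>UNIV. w j * (\<alpha> * Re (trace X'))) = \<alpha> * Re (trace X')"
      using w by (simp add: prob_vectors_def flip: sum_distrib_right)
    then show ?thesis
      using A that by (simp add: az_divergence_eq K_def distrib_left right_diff_distrib sum.distrib sum_subtractf)
  qed
  have less: "?f X < ?f X'" if X': "pos_def X'" "X' \<noteq> X" for X'
  proof -
    define Z where "Z = X' \<up> (\<alpha> / z)"
    have Z: "pos_def Z" "Z \<up> q = X'"
      using X' \<alpha> z0 by (simp_all add: Z_def q_def mpow_mpow)
    have ZY: "Z \<noteq> Y"
      using X'(2) Z Y by metis
    let ?G = "\<lambda>j. geom_mean z (Y \<up> (- 1)) (K j ** K j)"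
    let ?T = "\<lambda>j Y. Re (trace ((K j ** Y ** K j) \<up> z))"
    have "(\<Sum>j\<in>UNIV. w j * ?T j Z) < (\<Sum>j\<in>UNIV. w j * (?T j Y + z * Re (trace (?G j ** (Z - Y)))))"
      using w_pos trace_mpow_congruence_less[OF K Y(1) Z(1) ZY z0 z]
      by (intro sum_strict_mono mult_strict_left_mono) auto
    \<comment> \<open>By stationarity the weighted gradients add up to \<open>S\<close>, so this
      linear term cancels against that of the convex part.\<close>
    also have "\<dots> = (\<Sum>j\<in>UNIV. w j * ?T j Y) + z * Re (trace (S ** (Z - Y)))"
      by (simp add: S matrix_mult.sum_left matrix_mult.scaleR_left trace_sum trace_scaleR
          distrib_left sum.distrib sum_distrib_left mult_ac)
    finally have "(\<Sum>j\<in>UNIV. w j * ?T j Z) < (\<Sum>j\<in>UNIV. w j * ?T j Y) + z * Re (trace (S ** (Z - Y)))" .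
    moreover have "\<alpha> * (Re (trace X) + q * Re (trace (S ** (Z - Y)))) \<le> \<alpha> * Re (trace X')"
      using trace_mpow_ge[OF Z(1) Y(1) q(1)] \<alpha> by (intro mult_left_mono) (simp_all add: Y Z)
    then have "\<alpha> * Re (trace X) + z * Re (trace (S ** (Z - Y))) \<le> \<alpha> * Re (trace X')"
      by (simp only: distrib_left mult.assoc[symmetric] q(2))
    ultimately show ?thesis
      unfolding f[OF X] f[OF X'(1)] Y_def[symmetric] Z_def[symmetric] by linarith
  qed
  show ?thesis
    unfolding right_mean_def
  proof (rule the_equality)
    show "is_arg_min ?f pos_def X"
      unfolding is_arg_min_def
    proof (intro conjI notI)
      assume "\<exists>X'. pos_def X' \<and> ?f X' < ?f X"
      then obtain X' where X': "pos_def X'" "?f X' < ?f X"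
        by blast
      then have "X' \<noteq> X" by (intro notI) simp
      from less[OF X'(1) this] X'(2) show False by linarith
    qed (rule X)
    fix X' assume X': "is_arg_min ?f pos_def X'"
    show "X' = X"
    proof (rule ccontr)
      assume "X' \<noteq> X"
      with X' have "?f X < ?f X'"
        by (intro less) (auto simp: is_arg_min_def)
      with X X' show False
        unfolding is_arg_min_def by blast
    qed
  qed
qed

text \<open>The minimiser is constructed rather than found by minimising: a solution
  \<open>Y\<close> of the fixed-point equation gives \<open>X = Y \<up> (z / \<alpha>)\<close>, and
  congruence by \<open>Y \<up> (- (1/2))\<close> turns that equation into stationarity.\<close>

lemma right_mean_props:
  fixes A :: "'n::finite \<Rightarrow> 'm::finite cmat"
  assumes A: "\<And>j. pos_def (A j)" and w: "w \<in> prob_vectors"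
    and \<alpha>: "0 < \<alpha>" "\<alpha> \<le> z" and z: "z < 1"
  defines "X \<equiv> right_mean \<alpha> z w A"
  shows "pos_def X"
    and "X \<up> (1 - \<alpha> / z) = (\<Sum>j\<in>UNIV. w j *\<^sub>R geom_mean z (X \<up> (- (\<alpha> / z))) (A j \<up> ((1 - \<alpha>) / z)))"
proof -
  have z0: "0 < z" and \<alpha>1: "\<alpha> < 1" using \<alpha> z by simp_all
  let ?C = "\<lambda>j. A j \<up> ((1 - \<alpha>) / z)"
  obtain Y where Y: "pos_def Y"
    "Y \<up> (z / \<alpha>) = (\<Sum>j\<in>UNIV. w j *\<^sub>R (Y \<up> (1/2) ** ?C j ** Y \<up> (1/2)) \<up> z)"
    using exists_stationary[OF w pos_def_mpow[OF A] \<alpha>(1) \<alpha>1 z0] .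
  define X' where "X' = Y \<up> (z / \<alpha>)"
  have X': "pos_def X'" "X' \<up> (- (\<alpha> / z)) = Y \<up> (- 1)"
    using Y(1) \<alpha> z0 by (simp_all add: X'_def mpow_mpow)
  \<comment> \<open>Both sides are \<open>z / \<alpha> - 1\<close>; the three summands let
    \<open>mpow_add\<close> exhibit the congruence by \<open>Y \<up> (- (1/2))\<close>.\<close>
  have "z / \<alpha> * (1 - \<alpha> / z) = - (1/2) + z / \<alpha> + - (1/2)"
    using \<alpha> z0 by (simp add: field_simps)
  then have "X' \<up> (1 - \<alpha> / z) = Y \<up> (- (1/2)) ** X' ** Y \<up> (- (1/2))"
    by (simp only: X'_def mpow_mpow[OF Y(1)] mpow_add[OF Y(1)])
  also have "\<dots> = (\<Sum>j\<in>UNIV. w j *\<^sub>R (Y \<up> (- (1/2)) ** (Y \<up> (1/2) ** ?C j ** Y \<up> (1/2)) \<up> z ** Y \<up> (- (1/2))))"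
    unfolding X'_def Y(2) by (simp add: matrix_mult.sum_left matrix_mult.sum_right
        matrix_mult.scaleR_left matrix_mult.scaleR_right)
  also have "\<dots> = (\<Sum>j\<in>UNIV. w j *\<^sub>R geom_mean z (X' \<up> (- (\<alpha> / z))) (?C j))"
    unfolding X'(2) by (simp only: geom_mean_mpow_minus_1[OF Y(1)])
  finally have stat: "X' \<up> (1 - \<alpha> / z) = (\<Sum>j\<in>UNIV. w j *\<^sub>R geom_mean z (X' \<up> (- (\<alpha> / z))) (?C j))" .
  have "X = X'"
    unfolding X_def by (rule right_mean_eq[OF A w \<alpha> z X'(1) stat])
  with X'(1) stat show "pos_def X"
    "X \<up> (1 - \<alpha> / z) = (\<Sum>j\<in>UNIV. w j *\<^sub>R geom_mean z (X \<up> (- (\<alpha> / z))) (?C j))"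
    by simp_all
qed

lemma right_mean_subsolution:
  fixes A :: "'n::finite \<Rightarrow> 'm::finite cmat"
  assumes A: "\<And>j. pos_def (A j)" and w: "w \<in> prob_vectors"
    and \<alpha>: "0 < \<alpha>" "\<alpha> \<le> z" and z: "z < 1"
    and ge: "mat 1 \<le>\<^sub>L right_mean \<alpha> z w A"
  defines "S \<equiv> right_mean \<alpha> z w A \<up> (1 - \<alpha> / z)"
  shows "pos_def S" and "S \<le>\<^sub>L (\<Sum>j\<in>UNIV. w j *\<^sub>R geom_mean z S (A j \<up> ((1 - \<alpha>) / z)))"
proof -
  let ?X = "right_mean \<alpha> z w A"
  note X = right_mean_props[OF A w \<alpha> z]
  have w_nonneg: "0 \<le> w j" for j
    using w by (simp add: prob_vectors_def less_imp_le)
  show "pos_def S"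
    using X(1) by (simp add: S_def)
  \<comment> \<open>Here the lower bound \<open>mat 1\<close> enters: the eigenvalues of
    \<open>?X\<close> are at least 1, so raising the exponent by 1 enlarges the power.\<close>
  have "?X \<up> (- (\<alpha> / z)) \<le>\<^sub>L S"
    unfolding S_def by (rule mpow_mono_exponent[OF X(1) ge]) simp
  then have "(\<Sum>j\<in>UNIV. w j *\<^sub>R geom_mean z (?X \<up> (- (\<alpha> / z))) (A j \<up> ((1 - \<alpha>) / z)))
      \<le>\<^sub>L (\<Sum>j\<in>UNIV. w j *\<^sub>R geom_mean z S (A j \<up> ((1 - \<alpha>) / z)))"
    using X(1) A w_nonneg \<alpha> z by (intro loewner_le_sum loewner_le_scaleR geom_mean_mono) auto
  then show "S \<le>\<^sub>L (\<Sum>j\<in>UNIV. w j *\<^sub>R geom_mean z S (A j \<up> ((1 - \<alpha>) / z)))"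
    by (simp only: X(2)[symmetric] S_def[symmetric])
qed

section \<open>Combining the two means on the product index set\<close>

lemma weight_tensor_prob_vectors:
  assumes "w \<in> prob_vectors" "u \<in> prob_vectors"
  shows "weight_tensor w u \<in> prob_vectors"
proof -
  have "(\<Sum>p\<in>UNIV. weight_tensor w u p) = (\<Sum>i\<in>UNIV. \<Sum>j\<in>UNIV. w i * u j)"
    by (simp add: weight_tensor_def sum.cartesian_product UNIV_Times_UNIV[symmetric] del: UNIV_Times_UNIV)
  also have "\<dots> = 1"
    using assms by (simp add: prob_vectors_def flip: sum_product)
  finally show ?thesis
    using assms by (auto simp: prob_vectors_def weight_tensor_def)
qed

theorem theorem5p4:
  fixes A B :: "'n::finite \<Rightarrow> complex ^ 'm::finite ^ 'm"
    and \<omega> \<mu> :: "'n \<Rightarrow> real"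
    and \<alpha> z :: real
  assumes "\<And>j. pos_def (A j)" and "\<And>j. pos_def (B j)"
    and "\<omega> \<in> prob_vectors" and "\<mu> \<in> prob_vectors"
    and "0 < \<alpha>" and "\<alpha> \<le> z" and "z < 1"
    and "mat 1 \<le>\<^sub>L right_mean \<alpha> z \<omega> A"
    and "mat 1 \<le>\<^sub>L right_mean \<alpha> z \<mu> B"
  shows "(right_mean \<alpha> z \<omega> A) \<up> (1 - \<alpha> / z) \<odot> (right_mean \<alpha> z \<mu> B) \<up> (1 - \<alpha> / z)
    \<le>\<^sub>L power_mean z (weight_tensor \<omega> \<mu>)
          (tuple_hadamard (tuple_mpow A ((1 - \<alpha>) / z)) (tuple_mpow B ((1 - \<alpha>) / z)))"
proof -
  let ?S = "right_mean \<alpha> z \<omega> A \<up> (1 - \<alpha> / z)" and ?T = "right_mean \<alpha> z \<mu> B \<up> (1 - \<alpha> / z)"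
  let ?C = "\<lambda>j. A j \<up> ((1 - \<alpha>) / z)" and ?D = "\<lambda>j. B j \<up> ((1 - \<alpha>) / z)"
  let ?w = "weight_tensor \<omega> \<mu>"
  define E where "E = tuple_hadamard (tuple_mpow A ((1 - \<alpha>) / z)) (tuple_mpow B ((1 - \<alpha>) / z))"
  note S = right_mean_subsolution[OF assms(1,3,5,6,7,8)]
  note T = right_mean_subsolution[OF assms(2,4,5,6,7,9)]
  have z: "0 < z" "z \<le> 1" using assms(5-7) by simp_all
  have CD: "pos_def (?C j)" "pos_def (?D j)" for j
    using assms(1,2) by simp_all
  have E_pair: "E (i, j) = ?C i \<odot> ?D j" for i j
    by (simp add: E_def tuple_hadamard_def tuple_mpow_def)
  have E: "pos_def (E p)" for p
    by (cases p) (simp add: E_pair pos_def_hadamard CD)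
  have w: "?w \<in> prob_vectors"
    using assms(3,4) by (rule weight_tensor_prob_vectors)
  then have w_nonneg: "0 \<le> ?w p" for p
    by (cases p) (simp add: prob_vectors_def less_imp_le)
  have ST: "pos_def (?S \<odot> ?T)"
    using S(1) T(1) by (rule pos_def_hadamard)
  \<comment> \<open>The first sum is positive definite because it dominates \<open>?S\<close>; this
    supplies the semidefinite upper factor required by \<open>hadamard_mono\<close>.\<close>
  have "?S \<odot> ?T \<le>\<^sub>L (\<Sum>i\<in>UNIV. \<omega> i *\<^sub>R geom_mean z ?S (?C i)) \<odot> (\<Sum>j\<in>UNIV. \<mu> j *\<^sub>R geom_mean z ?T (?D j))"
    by (intro hadamard_mono S(2) T(2) pos_def_imp_pos_semidef[OF pos_def_loewner_le[OF S]]
        pos_def_imp_pos_semidef[OF T(1)])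
  also have "\<dots> = (\<Sum>i\<in>UNIV. \<Sum>j\<in>UNIV. ?w (i, j) *\<^sub>R (geom_mean z ?S (?C i) \<odot> geom_mean z ?T (?D j)))"
    by (simp only: hadamard.sum_left)
      (simp add: weight_tensor_def hadamard.sum_right hadamard.scaleR_left
        hadamard.scaleR_right scaleR_sum_right mult.commute)
  also have "\<dots> \<le>\<^sub>L (\<Sum>i\<in>UNIV. \<Sum>j\<in>UNIV. ?w (i, j) *\<^sub>R geom_mean z (?S \<odot> ?T) (E (i, j)))"
    unfolding E_pair using S(1) T(1) CD w_nonneg z
    by (intro loewner_le_sum loewner_le_scaleR geom_mean_hadamard) auto
  also have "\<dots> = (\<Sum>p\<in>UNIV. ?w p *\<^sub>R geom_mean z (?S \<odot> ?T) (E p))"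
    by (simp add: sum.cartesian_product)
  finally have "?S \<odot> ?T \<le>\<^sub>L (\<Sum>p\<in>UNIV. ?w p *\<^sub>R geom_mean z (?S \<odot> ?T) (E p))" .
  note sub = this and P = power_mean_props[OF w E z]
  have "?S \<odot> ?T \<le>\<^sub>L power_mean z ?w E"
    \<comment> \<open>\<open>?S \<odot> ?T\<close> is a subsolution, and the power mean, as a fixed
      point, is a supersolution of the same map.\<close>
    by (rule power_mean_comparison[OF w_nonneg E z ST sub P(1)]) (simp only: P(2) loewner_le_refl)
  then show ?thesis
    by (simp only: E_def)
qed

end
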